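(* Let $(\mathcal{X},d)$ be a complete separable metric space in which closed bounded sets are compact, and $I=[0,T]\subset\mathbb{R}$. Let $1<p<\infty$ and $\frac1p<\alpha<1$. Let $(\mu_t)_{t\in I}\subset P(\mathcal{X})$ be such that $\mu_0\in P_p(\mathcal{X})$ and such that it has a lift of finite $W^{\alpha,p}$-energy, i.e. there are $\tilde\pi\in\mathrm{Lift}(\mu_t)$ and $\bar x\in\mathcal{X}$ with $\int\big(d(\gamma_0,\bar x)^p+|\gamma|_{W^{\alpha,p}}^p\big)\,d\tilde\pi(\gamma)<+\infty$. Then there exists a minimizer $\pi\in P(C(I;\mathcal{X}))$ of the problem $$\inf_{\pi'\in\mathrm{Lift}(\mu_t)}\int_{C(I;\mathcal{X})}|\gamma|_{W^{\alpha,p}}^p\,d\pi'(\gamma).$$ In particular: (i) $\pi$ is concentrated on $W^{\alpha,p}(I;\mathcal{X})\subset C(I;\mathcal{X})$; (ii) $(e_t)_\#\pi=\mu_t$ for all $t\in I$; (iii) $|\mu|_{W^{\alpha,p}}^p\le\int_{C(I;\mathcal{X})}|\gamma|_{W^{\alpha,p}}^p\,d\pi(\gamma)<+\infty$. The same statement holds (with $T=1$) when $|\cdot|_{W^{\alpha,p}}$ and $W^{\alpha,p}$ are replaced everywhere by $|\cdot|_{b^{\alpha,p}}$ and $b^{\alpha,p}$.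
   Context: $C(I;\mathcal{X})$ is the space of continuous paths with the supremum distance and its Borel $\sigma$-algebra; $P(\mathcal{Y})$ denotes Borel probability measures on $\mathcal{Y}$; $e_t(\gamma)=\gamma_t$. The set of lifts is $\mathrm{Lift}(\mu_t)=\{\pi\in P(C(I;\mathcal{X})):(e_t)_\#\pi=\mu_t\ \forall t\in I\}$. $P_p(\mathcal{X})$ is the set of Borel probability measures with finite $p$-th moment, with the $p$-Wasserstein distance $W_p$ (given by the same formula, with values in $[0,\infty]$, on $P(\mathcal{X})$). "Concentrated on $A$" means $\pi(A)=1$. For a metric space $(\mathcal{Y},\rho)$, $1<p<\infty$, $\frac1p<\alpha<1$, and a path $X:[0,T]\to\mathcal{Y}$: $$|X|_{W^{\alpha,p}}=\Big(\iint_{[0,T]^2}\frac{\rho(X_s,X_t)^p}{|t-s|^{1+\alpha p}}\,ds\,dt\Big)^{1/p},$$ and $W^{\alpha,p}([0,T];\mathcal{Y})$ is the set of continuous paths $X$ with $|X|_{W^{\alpha,p}}<\infty$. For $T=1$, $$|X|_{b^{\alpha,p}}=\Big(\sum_{m=0}^\infty 2^{m(\alpha p-1)}\sum_{k=0}^{2^m-1}\rho\big(X_{k/2^m},X_{(k+1)/2^m}\big)^p\Big)^{1/p},$$ and $b^{\alpha,p}([0,1];\mathcal{Y})$ is the set of continuous paths with $|X|_{b^{\alpha,p}}<\infty$. For curves of measures, $|\mu|_{W^{\alpha,p}}$ and $|\mu|_{b^{\alpha,p}}$ are taken with respect to $\rho=W_p$. *)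

theory Defs
  imports "HOL-Probability.Probability"
begin

text \<open>
  The library has no real powers on \<^typ>\<open>ennreal\<close>. The following one is used for exponents
  \<open>r > 0\<close> only, with \<open>\<infinity>\<^sup>r = \<infinity>\<close> and \<open>0\<^sup>r = 0\<close>.
\<close>

definition ennreal_powr :: "ennreal \<Rightarrow> real \<Rightarrow> ennreal"
  where "ennreal_powr x r = (if x = \<infinity> then \<infinity> else ennreal (enn2real x powr r))"

text \<open>
  Paths in \<open>C([0,T]; \<X>)\<close> are functions on \<^typ>\<open>real\<close> that are \<^term>\<open>undefined\<close> outside
  \<open>[0,T]\<close> (the library's \<^const>\<open>cfunspace\<close> is extensional), so that a path is determined by its
  values on \<open>[0,T]\<close>. The boundedness built into \<^const>\<open>cfunspace\<close> is automatic here, since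
  \<open>[0,T]\<close> is compact.
\<close>

definition path_metric :: "real \<Rightarrow> (real \<Rightarrow> 'a::metric_space) metric"
  where "path_metric T = cfunspace (top_of_set {0..T}) euclidean_metric"

definition path_borel :: "real \<Rightarrow> (real \<Rightarrow> 'a::metric_space) measure"
  where "path_borel T =
    sigma (mspace (path_metric T)) {U. openin (mtopology_of (path_metric T)) U}"

lemma mspace_path_metric:
  "mspace (path_metric T) = {\<gamma>. continuous_on {0..T} \<gamma> \<and> \<gamma> \<in> extensional {0..T}}"
  by (auto simp: path_metric_def compact_continuous_image compact_imp_bounded)

lemma mdist_path_metric:
  assumes "\<gamma> \<in> mspace (path_metric T)" "\<eta> \<in> mspace (path_metric T)" "0 \<le> T"
  shows "mdist (path_metric T) \<gamma> \<eta> = (SUP t\<in>{0..T}. dist (\<gamma> t) (\<eta> t))"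
proof (rule antisym)
  have *: "mdist (path_metric T) \<gamma> \<eta> \<le> a \<longleftrightarrow> (\<forall>t\<in>{0..T}. dist (\<gamma> t) (\<eta> t) \<le> a)" for a
    using assms unfolding path_metric_def by (subst cfunspace_mdist_le) auto
  have bdd: "bdd_above ((\<lambda>t. dist (\<gamma> t) (\<eta> t)) ` {0..T})"
    using *[of "mdist (path_metric T) \<gamma> \<eta>"]
    by (intro bdd_aboveI2[where M = "mdist (path_metric T) \<gamma> \<eta>"]) blast
  show "mdist (path_metric T) \<gamma> \<eta> \<le> (SUP t\<in>{0..T}. dist (\<gamma> t) (\<eta> t))"
    unfolding * using bdd by (auto intro: cSUP_upper)
  show "(SUP t\<in>{0..T}. dist (\<gamma> t) (\<eta> t)) \<le> mdist (path_metric T) \<gamma> \<eta>"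
    using *[of "mdist (path_metric T) \<gamma> \<eta>"] assms(3) by (intro cSUP_least) auto
qed

lemma
  fixes T :: real
  shows space_path_borel:
      "space (path_borel T :: (real \<Rightarrow> 'a::metric_space) measure) = mspace (path_metric T)"
    and sets_path_borel:
      "sets (path_borel T :: (real \<Rightarrow> 'a) measure) =
        sigma_sets (mspace (path_metric T)) {U. openin (mtopology_of (path_metric T)) U}"
proof -
  have "{U. openin (mtopology_of (path_metric T :: (real \<Rightarrow> 'a) metric)) U}
      \<subseteq> Pow (mspace (path_metric T))"
    using openin_subset by fastforce
  then show "space (path_borel T :: (real \<Rightarrow> 'a) measure) = mspace (path_metric T)"
    "sets (path_borel T :: (real \<Rightarrow> 'a) measure) =
      sigma_sets (mspace (path_metric T)) {U. openin (mtopology_of (path_metric T)) U}"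
    by (simp_all add: path_borel_def space_measure_of sets_measure_of)
qed

text \<open>
  The evaluation maps are measurable, so \<^const>\<open>distr\<close> below really is the push-forward
  \<open>(e\<^sub>t)\<^sub>#\<pi>\<close>.
\<close>

lemma measurable_eval_path:
  assumes "t \<in> {0..T}"
  shows "(\<lambda>\<gamma>. \<gamma> t) \<in> path_borel T \<rightarrow>\<^sub>M (borel :: 'a::metric_space measure)"
proof (rule borel_measurableI)
  fix S :: "'a set" assume S: "open S"
  interpret M: Metric_space "mspace (path_metric T)" "mdist (path_metric T :: (real \<Rightarrow> 'a) metric)"
    by (rule Metric_space_mspace_mdist)
  let ?U = "(\<lambda>\<gamma>. \<gamma> t) -` S \<inter> mspace (path_metric T)"
  have "openin (mtopology_of (path_metric T)) ?U"
    unfolding mtopology_of_def M.openin_mtopology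
  proof (intro conjI allI impI)
    fix \<gamma> assume \<gamma>: "\<gamma> \<in> ?U"
    then obtain e where e: "e > 0" "\<And>y. dist y (\<gamma> t) < e \<Longrightarrow> y \<in> S"
      using S by (auto simp: open_dist)
    have "M.mball \<gamma> e \<subseteq> ?U"
    proof
      fix \<eta> assume \<eta>: "\<eta> \<in> M.mball \<gamma> e"
      then have "dist (\<gamma> t) (\<eta> t) \<le> mdist (path_metric T) \<gamma> \<eta>"
        using mdist_cfunspace_imp_mdist_le[of \<gamma> "top_of_set {0..T}" euclidean_metric \<eta>
            "mdist (path_metric T) \<gamma> \<eta>" t] assms
        unfolding path_metric_def[symmetric] M.in_mball by simp
      then show "\<eta> \<in> ?U" using \<eta> e by (auto simp: M.in_mball dist_commute)
    qed
    then show "\<exists>r>0. M.mball \<gamma> r \<subseteq> ?U" using e by blast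
  qed auto
  then show "(\<lambda>\<gamma>. \<gamma> t) -` S \<inter> space (path_borel T) \<in> sets (path_borel T)"
    by (auto simp: space_path_borel sets_path_borel)
qed

definition lifts :: "real \<Rightarrow> (real \<Rightarrow> 'a::metric_space measure) \<Rightarrow> (real \<Rightarrow> 'a) measure set"
  where "lifts T \<mu> =
    {\<pi> \<in> space (prob_algebra (path_borel T)). \<forall>t\<in>{0..T}. distr \<pi> borel (\<lambda>\<gamma>. \<gamma> t) = \<mu> t}"

definition finite_moment_probs :: "real \<Rightarrow> 'a::metric_space measure set"
  where "finite_moment_probs p =
    {\<mu> \<in> space (prob_algebra borel). \<exists>x0. (\<integral>\<^sup>+ x. ennreal (dist x x0 powr p) \<partial>\<mu>) < \<infinity>}"

definition couplings :: "'a::metric_space measure \<Rightarrow> 'a measure \<Rightarrow> ('a \<times> 'a) measure set"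
  where "couplings \<mu> \<nu> =
    {\<kappa> \<in> space (prob_algebra borel). distr \<kappa> borel fst = \<mu> \<and> distr \<kappa> borel snd = \<nu>}"

definition wasserstein :: "real \<Rightarrow> 'a::metric_space measure \<Rightarrow> 'a measure \<Rightarrow> ennreal"
  where "wasserstein p \<mu> \<nu> =
    ennreal_powr (INF \<kappa>\<in>couplings \<mu> \<nu>. \<integral>\<^sup>+ z. ennreal (dist (fst z) (snd z) powr p) \<partial>\<kappa>) (1 / p)"

text \<open>
  The seminorms take the distance \<open>\<rho>\<close> as an \<^typ>\<open>ennreal\<close>-valued argument, because they are
  also applied to curves of measures with \<open>\<rho> = wasserstein p\<close>, which may be infinite. On the
  null set \<open>s = t\<close> the integrand is \<open>0 / 0 = 0\<close> if \<open>\<rho> x x = 0\<close>.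
\<close>

definition frac_seminorm ::
    "('b \<Rightarrow> 'b \<Rightarrow> ennreal) \<Rightarrow> real \<Rightarrow> real \<Rightarrow> real \<Rightarrow> (real \<Rightarrow> 'b) \<Rightarrow> ennreal"
  where "frac_seminorm \<rho> \<alpha> p T X =
    ennreal_powr
      (\<integral>\<^sup>+ (s, t) \<in> {0..T} \<times> {0..T}.
         (ennreal_powr (\<rho> (X s) (X t)) p / ennreal (\<bar>t - s\<bar> powr (1 + \<alpha> * p)))
         \<partial>(lborel \<Otimes>\<^sub>M lborel))
      (1 / p)"

definition dyadic_seminorm ::
    "('b \<Rightarrow> 'b \<Rightarrow> ennreal) \<Rightarrow> real \<Rightarrow> real \<Rightarrow> (real \<Rightarrow> 'b) \<Rightarrow> ennreal"
  where "dyadic_seminorm \<rho> \<alpha> p X =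
    ennreal_powr
      (\<Sum>m. ennreal (2 powr (real m * (\<alpha> * p - 1))) *
        (\<Sum>k<2 ^ m. ennreal_powr (\<rho> (X (real k / 2 ^ m)) (X (real (k + 1) / 2 ^ m))) p))
      (1 / p)"

abbreviation edist :: "'a::metric_space \<Rightarrow> 'a \<Rightarrow> ennreal"
  where "edist x y \<equiv> ennreal (dist x y)"

definition frac_paths :: "real \<Rightarrow> real \<Rightarrow> real \<Rightarrow> (real \<Rightarrow> 'a::metric_space) set"
  where "frac_paths \<alpha> p T = {\<gamma> \<in> mspace (path_metric T). frac_seminorm edist \<alpha> p T \<gamma> < \<infinity>}"

definition dyadic_paths :: "real \<Rightarrow> real \<Rightarrow> (real \<Rightarrow> 'a::metric_space) set"
  where "dyadic_paths \<alpha> p = {\<gamma> \<in> mspace (path_metric 1). dyadic_seminorm edist \<alpha> p \<gamma> < \<infinity>}"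

end

theory Submission
  imports Defs
begin

text \<open>
  The direct method, with an almost sure coupling in place of Prokhorov's theorem. A path is encoded by
  one real number whose ternary digits record in which small balls it lies at a countable dense set of
  times. Along a minimising sequence of lifts, Helly's and Skorohod's theorems on the real line give
  random paths on one probability space whose laws form a subsequence and whose codes converge. By Fatou's
  lemma almost every realisation has finite lower limit of the energies (plus \<open>d(\<gamma>\<^sub>0, x0)\<^sup>p\<close>, whose
  integral depends on \<open>\<mu>\<^sub>0\<close> only). The sublevels of the energy are equicontinuous, closed balls of the
  target are compact, and code convergence fixes the cluster point at the dense times, which determines a
  random limit path. Its law is a lift, because the marginals are fixed, and lower semicontinuity
  of the energy makes it a minimiser.
\<close>

subsection \<open>The Borel algebra of the path space\<close>

text \<open>Coding makes tightness automatic: all codes lie in \<open>{0..1}\<close>, whatever the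
  energies are. The price is that a limit of codes need not be the code of a path, since membership
  in an open ball is not stable under limits. So the limit path is not decoded from the limit code;
  it is built for each realisation by compactness, and this is where the energy bound is spent. The
  subsequence used there depends on the realisation, which threatens measurability of the limit. The
  way out is that frozen digits make the whole sequence converge at every time \<open>D m\<close>:
  the values of the limit at these times are limits of random variables, and a random path is
  measurable as soon as its values at a countable dense set of times are. The condition
  \<open>1 / p < \<alpha>\<close> enters through equicontinuity of the sublevels, as positivity of
  the Hoelder exponent \<open>\<alpha> - 1 / p\<close>. Both seminorms are instances of one weighted
  integral over pairs of times, so that apart from this rewriting and equicontinuity everything is
  proved once.\<close>

lemma mdist_path_metric_le:
  assumes "\<gamma> \<in> mspace (path_metric T)" "\<eta> \<in> mspace (path_metric T)" "0 \<le> T"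
    and "\<And>t. t \<in> {0..T} \<Longrightarrow> dist (\<gamma> t) (\<eta> t) \<le> a"
  shows "mdist (path_metric T) \<gamma> \<eta> \<le> a"
  using assms by (auto simp: mdist_path_metric intro: cSUP_least)

lemma dist_le_on_closure:
  fixes f g :: "'c::metric_space \<Rightarrow> 'a::metric_space"
  assumes cont: "continuous_on S f" "continuous_on S g"
    and D: "D \<subseteq> S" "S \<subseteq> closure D" and le: "\<And>t. t \<in> D \<Longrightarrow> dist (f t) (g t) \<le> a" and t: "t \<in> S"
  shows "dist (f t) (g t) \<le> a"
proof -
  obtain s where s: "\<And>n. s n \<in> D" "s \<longlonglongrightarrow> t"
    using t D(2) closure_sequential by blast
  have "(\<lambda>n. dist (f (s n)) (g (s n))) \<longlonglongrightarrow> dist (f t) (g t)"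
    using s D(1) t by (intro tendsto_dist continuous_on_tendsto_compose[OF cont(1)]
        continuous_on_tendsto_compose[OF cont(2)]) (auto intro!: always_eventually)
  then show ?thesis
    using le s(1) by (intro LIMSEQ_le_const2[where X = "\<lambda>n. dist (f (s n)) (g (s n))"]) auto
qed

text \<open>
  The sup-metric space of paths is second countable: the open sets are countable unions of the
  closed tubes \<open>tube n ys j\<close> around step functions with mesh \<open>1/n\<close> and values \<open>ys\<close> in a countable
  dense set. A tube only tests the values of a path on the countable dense set of times \<open>D\<close>.
\<close>

lemma measurable_path_borelI:
  fixes G :: "'b \<Rightarrow> real \<Rightarrow> 'a::{metric_space, second_countable_topology}"
  assumes T: "0 \<le> T" and D: "countable D" "D \<subseteq> {0..T}" "{0..T} \<subseteq> closure D"
    and sp: "\<And>\<omega>. \<omega> \<in> space M \<Longrightarrow> G \<omega> \<in> mspace (path_metric T)"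
    and ev: "\<And>t. t \<in> D \<Longrightarrow> (\<lambda>\<omega>. G \<omega> t) \<in> borel_measurable M"
  shows "G \<in> M \<rightarrow>\<^sub>M path_borel T"
proof (rule measurable_sigma_sets[OF sets_path_borel])
  show "{U. openin (mtopology_of (path_metric T :: (real \<Rightarrow> 'a) metric)) U} \<subseteq> Pow (mspace (path_metric T))"
    using openin_subset by fastforce
  show "G \<in> space M \<rightarrow> mspace (path_metric T)" using sp by auto
  fix U assume "U \<in> {U. openin (mtopology_of (path_metric T :: (real \<Rightarrow> 'a) metric)) U}"
  then have U: "openin (mtopology_of (path_metric T :: (real \<Rightarrow> 'a) metric)) U" by simp
  interpret C: Metric_space "mspace (path_metric T)" "mdist (path_metric T :: (real \<Rightarrow> 'a) metric)"
    by (rule Metric_space_mspace_mdist)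
  obtain Q :: "'a set" where Q: "countable Q" "\<And>U. open U \<Longrightarrow> U \<noteq> {} \<Longrightarrow> \<exists>y\<in>Q. y \<in> U"
    using countable_dense_setE by blast
  define tube where "tube n ys j = {\<eta> \<in> mspace (path_metric T).
      \<forall>t\<in>D. dist (\<eta> t) (ys ! nat \<lfloor>t * real n\<rfloor>) \<le> 1 / Suc j}" for n j :: nat and ys :: "'a list"
  define \<A> where "\<A> = {(n, ys, j). tube n ys j \<subseteq> U \<and> ys \<in> lists Q}"
  have "\<A> \<subseteq> UNIV \<times> lists Q \<times> UNIV" by (auto simp: \<A>_def)
  moreover have "countable (UNIV \<times> lists Q \<times> (UNIV :: nat set) :: (nat \<times> 'a list \<times> nat) set)"
    using Q by (intro countable_SIGMA countable_lists) auto
  ultimately have cA: "countable \<A>" using countable_subset by blast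
  have UA: "U = (\<Union>(n, ys, j)\<in>\<A>. tube n ys j)"
  proof (intro set_eqI iffI)
    fix \<gamma> assume "\<gamma> \<in> U"
    then obtain r where r: "r > 0" "C.mball \<gamma> r \<subseteq> U" and \<gamma>: "\<gamma> \<in> mspace (path_metric T)"
      using U unfolding mtopology_of_def C.openin_mtopology by blast
    then have "continuous_on {0..T} \<gamma>" by (simp add: mspace_path_metric)
    then have "uniformly_continuous_on {0..T} \<gamma>" by (simp add: compact_uniformly_continuous)
    \<comment> \<open>Two paths in a common tube are within \<open>2 / Suc j\<close> of each other,
      and this has to stay below \<open>r\<close>.\<close>
    obtain j where j: "1 / Suc j < r / 2" using r(1) nat_approx_posE[of "r / 2"] by auto
    \<comment> \<open>Half the tube radius: one half for the oscillation of \<open>\<gamma>\<close>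
      over a mesh interval, the other for moving the grid value into \<open>Q\<close>.\<close>
    define e where "e = 1 / (2 * real (Suc j))"
    have e: "e > 0" "e + e = 1 / Suc j" by (auto simp: e_def field_simps)
    obtain d where d: "d > 0" "\<And>s t. s \<in> {0..T} \<Longrightarrow> t \<in> {0..T} \<Longrightarrow> dist s t < d \<Longrightarrow> dist (\<gamma> s) (\<gamma> t) < e"
      using \<open>uniformly_continuous_on {0..T} \<gamma>\<close> e unfolding uniformly_continuous_on_def by metis
    obtain m where m: "1 / Suc m < d" using d(1) nat_approx_posE by auto
    define n where "n = Suc m"
    have "\<exists>y\<in>Q. y \<in> ball (\<gamma> (real k / n)) e" for k :: nat
      using Q(2)[of "ball (\<gamma> (real k / n)) e"] e by auto
    then obtain y where y: "\<And>k. y k \<in> Q" "\<And>k. dist (\<gamma> (real k / n)) (y k) < e"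
      by (metis mem_ball)
    define ys where "ys = map y [0..<Suc (nat \<lfloor>T * n\<rfloor>)]"
    have yv: "dist (\<gamma> t) (ys ! nat \<lfloor>t * n\<rfloor>) \<le> 1 / Suc j" if t: "t \<in> D" for t :: real
    proof -
      have tT: "t \<in> {0..T}" using t D by auto
      define k where "k = nat \<lfloor>t * n\<rfloor>"
      have "\<lfloor>t * n\<rfloor> \<le> \<lfloor>T * n\<rfloor>" using tT by (intro floor_mono mult_right_mono) auto
      then have "k < Suc (nat \<lfloor>T * n\<rfloor>)" by (auto simp: k_def)
      then have ysk: "ys ! k = y k" by (simp add: ys_def del: upt_Suc)
      have "real k = of_int \<lfloor>t * n\<rfloor>" using tT by (simp add: k_def)
      then have k: "real k \<le> t * n" "t * n < real k + 1" by linarith+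
      have kn: "real k / n \<le> t" "t - real k / n < 1 / n"
        using k pos_less_divide_eq[of "real n" t "real k + 1"]
        by (simp_all add: n_def pos_divide_le_eq add_divide_distrib algebra_simps)
      then have "real k / n \<in> {0..T}" "dist t (real k / n) < d" using tT m by (auto simp: dist_real_def n_def)
      then have "dist (\<gamma> t) (\<gamma> (real k / n)) < e" using d(2) tT by blast
      then have "dist (\<gamma> t) (y k) \<le> 1 / Suc j"
        using y(2)[of k] dist_triangle[of "\<gamma> t" "y k" "\<gamma> (real k / n)"] e by linarith
      then show ?thesis using ysk by (simp add: k_def)
    qed
    have "tube n ys j \<subseteq> C.mball \<gamma> r"
    proof
      fix \<eta> assume \<eta>: "\<eta> \<in> tube n ys j"
      have "dist (\<gamma> t) (\<eta> t) \<le> 2 / Suc j" if t: "t \<in> D" for t :: real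
      proof -
        have "dist (\<eta> t) (ys ! nat \<lfloor>t * n\<rfloor>) \<le> 1 / Suc j" using \<eta> t by (auto simp: tube_def)
        moreover have "2 / real (Suc j) = 1 / Suc j + 1 / Suc j" by simp
        ultimately show ?thesis
          using yv[OF t] dist_triangle2[of "\<gamma> t" "\<eta> t" "ys ! nat \<lfloor>t * n\<rfloor>"] by linarith
      qed
      moreover have "continuous_on {0..T} \<eta>" "continuous_on {0..T} \<gamma>"
        using \<eta> \<gamma> by (auto simp: tube_def mspace_path_metric)
      ultimately have "dist (\<gamma> t) (\<eta> t) \<le> 2 / Suc j" if "t \<in> {0..T}" for t
        using dist_le_on_closure[OF _ _ D(2,3)] that by blast
      then have "mdist (path_metric T) \<gamma> \<eta> \<le> 2 / Suc j"
        using \<eta> \<gamma> T by (intro mdist_path_metric_le) (auto simp: tube_def)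
      also have "2 / real (Suc j) < r" using j by simp
      finally show "\<eta> \<in> C.mball \<gamma> r" using \<eta> \<gamma> by (auto simp: C.in_mball tube_def)
    qed
    moreover have "ys \<in> lists Q" using y by (auto simp: ys_def)
    ultimately have "(n, ys, j) \<in> \<A>" using r by (auto simp: \<A>_def)
    moreover have "\<gamma> \<in> tube n ys j" using yv \<gamma> by (auto simp: tube_def)
    ultimately show "\<gamma> \<in> (\<Union>(n, ys, j)\<in>\<A>. tube n ys j)" by blast
  qed (auto simp: \<A>_def)
  have "G -` tube n ys j \<inter> space M \<in> sets M" for n ys j
  proof -
    have "G -` tube n ys j \<inter> space M =
        {\<omega> \<in> space M. \<forall>t\<in>D. dist (G \<omega> t) (ys ! nat \<lfloor>t * real n\<rfloor>) \<le> 1 / Suc j}"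
      using sp by (auto simp: tube_def)
    also have "\<dots> \<in> sets M"
    proof (rule sets.sets_Collect_countable_All'[OF _ D(1)])
      fix t assume "t \<in> D"
      note [measurable] = ev[OF this]
      show "{\<omega> \<in> space M. dist (G \<omega> t) (ys ! nat \<lfloor>t * real n\<rfloor>) \<le> 1 / Suc j} \<in> sets M" by measurable
    qed
    finally show ?thesis .
  qed
  moreover have "G -` U \<inter> space M = (\<Union>(n, ys, j)\<in>\<A>. G -` tube n ys j \<inter> space M)"
    using UA by blast
  ultimately show "G -` U \<inter> space M \<in> sets M" using cA by auto
qed

text \<open>Paths carry no information outside \<open>{0..T}\<close>. Composed with this retraction
  they are continuous on the whole line, so measurability in time can be stated on
  \<open>borel\<close>, and pairs of times may be indexed by the whole plane.\<close>

definition clamp_time :: "real \<Rightarrow> real \<Rightarrow> real"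
  where "clamp_time T t = max 0 (min T t)"

lemma clamp_time_in: "0 \<le> T \<Longrightarrow> clamp_time T t \<in> {0..T}"
  by (auto simp: clamp_time_def)

lemma clamp_time_id: "t \<in> {0..T} \<Longrightarrow> clamp_time T t = t"
  by (auto simp: clamp_time_def)

lemma continuous_clamp_time: "continuous_on S (clamp_time T)"
  unfolding clamp_time_def by (intro continuous_intros)

lemma measurable_clamp_time [measurable]: "clamp_time T \<in> borel_measurable borel"
  by (intro borel_measurable_continuous_onI continuous_clamp_time)

lemma continuous_path_clamp:
  assumes "0 \<le> T" "\<gamma> \<in> mspace (path_metric T)"
  shows "continuous_on UNIV (\<lambda>t. \<gamma> (clamp_time T t))"
  using assms clamp_time_in[OF assms(1)]
  by (intro continuous_on_compose2[OF _ continuous_clamp_time, of "{0..T}"]) (auto simp: mspace_path_metric)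

lemma floor_dyadic_LIMSEQ: "(\<lambda>k. real_of_int \<lfloor>2 ^ k * t\<rfloor> / 2 ^ k) \<longlonglongrightarrow> t"
proof (rule tendsto_sandwich)
  show "(\<lambda>k. t - (1 / 2) ^ k) \<longlonglongrightarrow> t"
    using tendsto_diff[OF tendsto_const LIMSEQ_power_zero[of "1 / 2 :: real"], of t] by simp
  show "\<forall>\<^sub>F k in sequentially. t - (1 / 2) ^ k \<le> real_of_int \<lfloor>2 ^ k * t\<rfloor> / 2 ^ k"
  proof (intro always_eventually allI)
    fix k show "t - (1 / 2) ^ k \<le> real_of_int \<lfloor>2 ^ k * t\<rfloor> / 2 ^ k"
    proof -
      have "t < (real_of_int \<lfloor>2 ^ k * t\<rfloor> + 1) / 2 ^ k"
        using floor_correct[of "2 ^ k * t"] by (simp add: pos_less_divide_eq mult.commute)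
      then show ?thesis by (simp add: add_divide_distrib power_one_over)
    qed
  qed
  show "\<forall>\<^sub>F k in sequentially. real_of_int \<lfloor>2 ^ k * t\<rfloor> / 2 ^ k \<le> t"
  proof (intro always_eventually allI)
    fix k show "real_of_int \<lfloor>2 ^ k * t\<rfloor> / 2 ^ k \<le> t"
      using floor_correct[of "2 ^ k * t"] by (simp add: field_simps)
  qed
qed auto

text \<open>Rounding the time down to a multiple of \<open>1 / 2 ^ k\<close> leaves countably many
  evaluations at fixed times, each measurable; continuity of the path recovers the evaluation as
  \<open>k\<close> grows. Tonelli's theorem for the energies rests on this joint
  measurability.\<close>

lemma measurable_eval_pair:
  assumes T: "0 \<le> T"
  shows "(\<lambda>(\<gamma>, t). \<gamma> (clamp_time T t)) \<in> path_borel T \<Otimes>\<^sub>M borel \<rightarrow>\<^sub>M (borel :: 'a::metric_space measure)"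
proof (rule borel_measurable_LIMSEQ_metric)
  fix k :: nat
  have ev: "(\<lambda>\<gamma>. \<gamma> (clamp_time T (real_of_int i / 2 ^ k))) \<in> path_borel T \<rightarrow>\<^sub>M (borel :: 'a measure)"
    for i using clamp_time_in[OF T] by (intro measurable_eval_path)
  define f :: "int \<Rightarrow> (real \<Rightarrow> 'a) \<times> real \<Rightarrow> 'a"
    where "f i x = fst x (clamp_time T (real_of_int i / 2 ^ k))" for i x
  have "f i \<in> path_borel T \<Otimes>\<^sub>M borel \<rightarrow>\<^sub>M borel" for i
    unfolding f_def by (rule measurable_compose[OF measurable_fst ev])
  moreover have "(\<lambda>x. \<lfloor>2 ^ k * snd x\<rfloor>) \<in> (path_borel T :: (real \<Rightarrow> 'a) measure) \<Otimes>\<^sub>M (borel :: real measure) \<rightarrow>\<^sub>M count_space UNIV"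
    by measurable
  ultimately have "(\<lambda>x. f \<lfloor>2 ^ k * snd x\<rfloor> x) \<in> path_borel T \<Otimes>\<^sub>M borel \<rightarrow>\<^sub>M borel"
    by (rule measurable_compose_countable)
  then show "(\<lambda>(\<gamma>, t). \<gamma> (clamp_time T (real_of_int \<lfloor>(2::real) ^ k * t\<rfloor> / 2 ^ k)))
      \<in> path_borel T \<Otimes>\<^sub>M borel \<rightarrow>\<^sub>M (borel :: 'a measure)"
    by (simp add: f_def case_prod_beta)
next
  fix x :: "(real \<Rightarrow> 'a) \<times> real" assume "x \<in> space (path_borel T \<Otimes>\<^sub>M borel)"
  then obtain \<gamma> t where x: "x = (\<gamma>, t)" and \<gamma>: "\<gamma> \<in> mspace (path_metric T)"
    by (auto simp: space_pair_measure space_path_borel)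
  have "(\<lambda>k. \<gamma> (clamp_time T (real_of_int \<lfloor>(2::real) ^ k * t\<rfloor> / 2 ^ k))) \<longlonglongrightarrow> \<gamma> (clamp_time T t)"
    using continuous_on_tendsto_compose[OF continuous_path_clamp[OF T \<gamma>] floor_dyadic_LIMSEQ] by simp
  then show "(\<lambda>k. (\<lambda>(\<gamma>, t). \<gamma> (clamp_time T (real_of_int \<lfloor>(2::real) ^ k * t\<rfloor> / 2 ^ k))) x)
      \<longlonglongrightarrow> (case x of (\<gamma>, t) \<Rightarrow> \<gamma> (clamp_time T t))"
    by (simp add: x)
qed

subsection \<open>Encoding paths by real numbers\<close>

text \<open>Half of the usual parametrisation of the Cantor set. In base two, the double expansions
  of dyadic numbers would let codes converge while a digit keeps changing; in base three, without
  the digit two, this cannot happen.\<close>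

definition ternary :: "(nat \<Rightarrow> bool) \<Rightarrow> real"
  where "ternary b = (\<Sum>j. of_bool (b j) / 3 ^ Suc j)"

lemma summable_ternary: "summable (\<lambda>j. of_bool (b j) / 3 ^ Suc j :: real)"
proof (rule summable_comparison_test')
  show "summable (\<lambda>j. (1 / 3) ^ j :: real)" by (intro summable_geometric) simp
  show "norm (of_bool (b j) / 3 ^ Suc j :: real) \<le> (1 / 3) ^ j" for j
    by (simp add: of_bool_def power_one_over frac_le)
qed

lemma ternary_nonneg: "0 \<le> ternary b"
  unfolding ternary_def by (intro suminf_nonneg summable_ternary) auto

lemma ternary_le: "ternary b \<le> 1 / 2"
proof -
  have s: "(\<lambda>j. (1 / 3) * (1 / 3) ^ j :: real) sums (1 / 3 * (1 / (1 - 1 / 3)))"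
    by (intro sums_mult geometric_sums) simp
  have "ternary b \<le> (\<Sum>j. (1 / 3) * (1 / 3) ^ j :: real)"
    unfolding ternary_def
    by (intro suminf_le summable_ternary sums_summable[OF s]) (simp add: of_bool_def power_one_over)
  then show ?thesis using sums_unique[OF s] by simp
qed

primrec ternary_prefix :: "(nat \<Rightarrow> bool) \<Rightarrow> nat \<Rightarrow> int" where
  "ternary_prefix b 0 = 0"
| "ternary_prefix b (Suc j) = 3 * ternary_prefix b j + of_bool (b j)"

lemma ternary_Suc: "3 * ternary b = of_bool (b 0) + ternary (\<lambda>i. b (Suc i))"
proof -
  have "ternary b = (\<Sum>j. of_bool (b (Suc j)) / 3 ^ Suc (Suc j)) + of_bool (b 0) / 3"
    unfolding ternary_def using suminf_split_head[OF summable_ternary[of b]] by simp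
  also have "(\<Sum>j. of_bool (b (Suc j)) / 3 ^ Suc (Suc j)) = ternary (\<lambda>i. b (Suc i)) / 3"
    unfolding ternary_def using suminf_divide[OF summable_ternary[of "\<lambda>i. b (Suc i)"], of 3]
    by (simp add: mult_ac)
  finally show ?thesis by simp
qed

lemma ternary_shift: "3 ^ j * ternary b = of_int (ternary_prefix b j) + ternary (\<lambda>i. b (i + j))"
proof (induction j)
  case (Suc j)
  have "3 ^ Suc j * ternary b = 3 * of_int (ternary_prefix b j) + 3 * ternary (\<lambda>i. b (i + j))"
    using Suc by (simp add: algebra_simps)
  also have "3 * ternary (\<lambda>i. b (i + j)) = of_bool (b j) + ternary (\<lambda>i. b (i + Suc j))"
    by (subst ternary_Suc) simp
  finally show ?case by simp
qed simp

text \<open>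
  Only the digits \<open>0\<close> and \<open>1\<close> occur, so the fractional part of \<open>3\<^sup>j * ternary b\<close> stays in
  \<open>[0, 1/2]\<close>: digits are locally constant functions of the real number.
\<close>

lemma ternary_digit: "\<lfloor>3 ^ Suc j * ternary b\<rfloor> mod 3 = 1 \<longleftrightarrow> b j"
proof -
  have "\<lfloor>3 ^ Suc j * ternary b\<rfloor> = ternary_prefix b (Suc j)"
    unfolding ternary_shift using ternary_nonneg[of "\<lambda>i. b (i + Suc j)"] ternary_le[of "\<lambda>i. b (i + Suc j)"]
    by (intro floor_unique) auto
  then show ?thesis by (auto simp: of_bool_def)
qed

text \<open>Numbers closer than \<open>1 / (2 * 3 ^ Suc j)\<close> differ by less than 1/2 after
  scaling by \<open>3 ^ Suc j\<close>, and the remainders, all in \<open>[0, 1/2]\<close>, differ by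
  at most 1/2. So the integer prefixes differ by less than one and agree; digit \<open>j\<close> is
  their residue modulo three.\<close>

lemma ternary_digits_eventually_constant:
  assumes "convergent (\<lambda>n. ternary (b n))"
  shows "\<exists>N. \<forall>n\<ge>N. b n j \<longleftrightarrow> b N j"
proof -
  have "Cauchy (\<lambda>n. ternary (b n))" using assms Cauchy_convergent_iff by blast
  then obtain N where N: "\<And>m n. m \<ge> N \<Longrightarrow> n \<ge> N \<Longrightarrow> dist (ternary (b m)) (ternary (b n)) < 1 / (2 * 3 ^ Suc j)"
    using metric_CauchyD[of "\<lambda>n. ternary (b n)" "1 / (2 * 3 ^ Suc j)"] by auto
  have "b n j \<longleftrightarrow> b N j" if "n \<ge> N" for n
  proof -
    let ?P = "\<lambda>n. ternary_prefix (b n) (Suc j)" and ?t = "\<lambda>n. ternary (\<lambda>i. b n (i + Suc j))"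
    have "3 ^ Suc j * \<bar>ternary (b n) - ternary (b N)\<bar> < 1 / 2"
      using N[OF that, of N] by (simp add: dist_real_def field_simps)
    then have "\<bar>3 ^ Suc j * ternary (b n) - 3 ^ Suc j * ternary (b N)\<bar> < 1 / 2"
      by (simp add: abs_mult right_diff_distrib[symmetric])
    then have "\<bar>real_of_int (?P n) - of_int (?P N)\<bar> < 1"
      unfolding ternary_shift using ternary_nonneg[of "\<lambda>i. b n (i + Suc j)"] ternary_le[of "\<lambda>i. b n (i + Suc j)"]
        ternary_nonneg[of "\<lambda>i. b N (i + Suc j)"] ternary_le[of "\<lambda>i. b N (i + Suc j)"] by linarith
    then have "?P n = ?P N" by linarith
    then have "?P n mod 3 = ?P N mod 3" by simp
    then show ?thesis by (auto simp: of_bool_def split: if_splits)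
  qed
  then show ?thesis by blast
qed

text \<open>
  A path is encoded by one real number whose ternary digits record, for all \<open>m\<close>, \<open>i\<close>, \<open>k\<close>, whether the path
  at the time \<open>D m\<close> lies in the ball around \<open>x i\<close> of radius \<open>1 / (k + 1)\<close>. It is decoded from the
  approximations \<open>appr y m k\<close> of its value at \<open>D m\<close>; a number is \<open>good\<close> if these converge to a uniformly
  continuous function on \<open>D\<close>.
\<close>

locale path_coding =
  fixes T :: real and D :: "nat \<Rightarrow> real" and x :: "nat \<Rightarrow> 'a::polish_space"
  assumes T: "0 \<le> T"
    and D_in: "\<And>m. D m \<in> {0..T}" and D_dense: "{0..T} \<subseteq> closure (range D)"
    and x_dense: "\<And>U. open U \<Longrightarrow> U \<noteq> {} \<Longrightarrow> \<exists>i. x i \<in> U"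
begin

definition cell :: "nat \<Rightarrow> nat \<Rightarrow> 'a set"
  where "cell i k = ball (x i) (1 / Suc k)"

definition code_path :: "(real \<Rightarrow> 'a) \<Rightarrow> real"
  where "code_path \<gamma> = ternary (\<lambda>j. case prod_decode j of (m, l) \<Rightarrow> case prod_decode l of (i, k) \<Rightarrow>
    \<gamma> (D m) \<in> cell i k)"

definition digit :: "real \<Rightarrow> nat \<Rightarrow> nat \<Rightarrow> nat \<Rightarrow> bool"
  where "digit y m i k \<longleftrightarrow> \<lfloor>3 ^ Suc (prod_encode (m, prod_encode (i, k))) * y\<rfloor> mod 3 = 1"

text \<open>If \<open>y\<close> is not a code, no digit need be set, and \<open>LEAST\<close> then
  gives an unspecified index; whether such values are usable is left to \<open>good\<close>.\<close>

definition appr :: "real \<Rightarrow> nat \<Rightarrow> nat \<Rightarrow> 'a"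
  where "appr y m k = x (LEAST i. digit y m i k)"

text \<open>A single condition covers the Cauchy property in the level and uniform continuity in
  time. All quantifiers range over natural numbers, which makes it a Borel condition on
  \<open>y\<close>.\<close>

definition good :: "real \<Rightarrow> bool"
  where "good y \<longleftrightarrow> (\<forall>l. \<exists>j. \<forall>k\<ge>j. \<forall>k'\<ge>j. \<forall>m m'. \<bar>D m - D m'\<bar> < 1 / Suc j \<longrightarrow>
    dist (appr y m k) (appr y m' k') \<le> 1 / Suc l)"

text \<open>One approximating sequence per time, the same for all \<open>y\<close>: decoding at
  \<open>t\<close> is then a pointwise limit of measurable functions of \<open>y\<close>.\<close>

definition times_to :: "real \<Rightarrow> nat \<Rightarrow> nat"
  where "times_to t = (SOME a. (\<lambda>k. D (a k)) \<longlonglongrightarrow> t)"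

text \<open>The constant path at \<open>x 0\<close> lets every real number decode to a path; the
  random numbers to be decoded are codes only almost surely.\<close>

definition decode_path :: "real \<Rightarrow> real \<Rightarrow> 'a"
  where "decode_path y = (\<lambda>t\<in>{0..T}. if good y then lim (\<lambda>k. appr y (times_to t k) k) else x 0)"

lemma times_to: "t \<in> {0..T} \<Longrightarrow> (\<lambda>k. D (times_to t k)) \<longlonglongrightarrow> t"
proof -
  assume "t \<in> {0..T}"
  then obtain s where s: "\<And>n. s n \<in> range D" "s \<longlonglongrightarrow> t"
    using D_dense closure_sequential by blast
  then have "\<forall>n. \<exists>m. s n = D m" by blast
  then obtain a where "\<forall>n. s n = D (a n)" by (rule choice[THEN exE])
  then have "(\<lambda>k. D (a k)) \<longlonglongrightarrow> t" using s(2) by (simp add: LIMSEQ_def)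
  then show ?thesis unfolding times_to_def by (rule someI[of "\<lambda>a. (\<lambda>k. D (a k)) \<longlonglongrightarrow> t"])
qed

lemma measurable_code_path: "code_path \<in> borel_measurable (path_borel T)"
proof -
  have [measurable]: "(\<lambda>\<gamma>. \<gamma> (D m)) \<in> path_borel T \<rightarrow>\<^sub>M (borel :: 'a measure)" for m
    using D_in by (rule measurable_eval_path)
  have [measurable]: "cell i k \<in> sets borel" for i k by (simp add: cell_def)
  have [measurable]: "Measurable.pred (path_borel T) (\<lambda>\<gamma>. \<gamma> (D m) \<in> cell i k)" for m i k
    by measurable
  show ?thesis
    unfolding code_path_def ternary_def case_prod_beta of_bool_def by measurable
qed

lemma digit_code_path: "digit (code_path \<gamma>) m i k \<longleftrightarrow> \<gamma> (D m) \<in> cell i k"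
  unfolding digit_def code_path_def ternary_digit by simp

lemma code_path_in: "code_path \<gamma> \<in> {0..1}"
  by (simp add: code_path_def ternary_nonneg order_trans[OF ternary_le])

lemma measurable_appr [measurable]: "(\<lambda>y. appr y m k) \<in> borel_measurable borel"
proof -
  have [measurable]: "Measurable.pred borel (\<lambda>y. digit y m i k)" for i
    unfolding digit_def by measurable
  show ?thesis unfolding appr_def
    by (rule measurable_compose[where N = "count_space UNIV"]) measurable
qed

lemma measurable_good [measurable]: "Measurable.pred borel good"
  unfolding good_def by measurable

lemma appr_code_path: "dist (appr (code_path \<gamma>) m k) (\<gamma> (D m)) < 1 / Suc k"
proof -
  obtain i where "x i \<in> ball (\<gamma> (D m)) (1 / Suc k)"
    using x_dense[of "ball (\<gamma> (D m)) (1 / Suc k)"] by auto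
  then have "digit (code_path \<gamma>) m i k" by (simp add: digit_code_path cell_def dist_commute)
  then have "digit (code_path \<gamma>) m (LEAST i. digit (code_path \<gamma>) m i k) k" by (rule LeastI)
  then show ?thesis by (simp add: digit_code_path cell_def appr_def)
qed

lemma good_code_path:
  assumes "\<gamma> \<in> mspace (path_metric T)"
  shows "good (code_path \<gamma>)"
  unfolding good_def
proof
  fix l
  have "uniformly_continuous_on {0..T} \<gamma>"
    using assms by (simp add: mspace_path_metric compact_uniformly_continuous)
  \<comment> \<open>A third of the tolerance: two approximation errors and one oscillation of
    \<open>\<gamma>\<close>.\<close>
  moreover define h where "h = 1 / (3 * real (Suc l))"
  then have "h > 0" by simp
  ultimately obtain d where d: "d > 0"
      "\<And>s t. s \<in> {0..T} \<Longrightarrow> t \<in> {0..T} \<Longrightarrow> dist s t < d \<Longrightarrow> dist (\<gamma> s) (\<gamma> t) < h"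
    unfolding uniformly_continuous_on_def by metis
  have "0 < min d h" using d(1) \<open>h > 0\<close> by simp
  then obtain j where j: "1 / Suc j < min d h" by (rule nat_approx_posE)
  have *: "dist (appr (code_path \<gamma>) m k) (\<gamma> (D m)) \<le> h" if "k \<ge> j" for m k
  proof -
    have "1 / real (Suc k) \<le> 1 / Suc j" using that by (simp add: frac_le)
    then show ?thesis using appr_code_path[of \<gamma> m k] j by linarith
  qed
  have "dist (appr (code_path \<gamma>) m k) (appr (code_path \<gamma>) m' k') \<le> 1 / Suc l"
    if k: "k \<ge> j" "k' \<ge> j" and m: "\<bar>D m - D m'\<bar> < 1 / Suc j" for k k' m m'
  proof -
    have "dist (\<gamma> (D m)) (\<gamma> (D m')) < h"
      using d(2)[OF D_in D_in, of m m'] m j by (simp add: dist_real_def)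
    moreover have "1 / real (Suc l) = h + h + h"
      by (simp add: h_def field_simps)
    ultimately show ?thesis
      using *[OF k(1), of m] *[OF k(2), of m']
        dist_triangle[of "appr (code_path \<gamma>) m k" "appr (code_path \<gamma>) m' k'" "\<gamma> (D m)"]
        dist_triangle2[of "\<gamma> (D m)" "appr (code_path \<gamma>) m' k'" "\<gamma> (D m')"] by linarith
  qed
  then show "\<exists>j. \<forall>k\<ge>j. \<forall>k'\<ge>j. \<forall>m m'. \<bar>D m - D m'\<bar> < 1 / Suc j \<longrightarrow>
      dist (appr (code_path \<gamma>) m k) (appr (code_path \<gamma>) m' k') \<le> 1 / Suc l"
    by blast
qed

text \<open>\<open>good\<close> compares approximations across levels and times at once, so the
  diagonal sequence, whose level is the index of the time, is Cauchy; the target is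
  complete.\<close>

lemma decode_path_LIMSEQ:
  assumes "good y" "t \<in> {0..T}"
  shows "(\<lambda>k. appr y (times_to t k) k) \<longlonglongrightarrow> decode_path y t"
proof -
  have "Cauchy (\<lambda>k. appr y (times_to t k) k)"
  proof (rule metric_CauchyI)
    fix e :: real assume "e > 0"
    then obtain l where l: "1 / Suc l < e" using nat_approx_posE by auto
    obtain j where j: "\<And>k k' m m'. k \<ge> j \<Longrightarrow> k' \<ge> j \<Longrightarrow> \<bar>D m - D m'\<bar> < 1 / Suc j \<Longrightarrow>
        dist (appr y m k) (appr y m' k') \<le> 1 / Suc l"
      using assms(1) unfolding good_def by blast
    have "Cauchy (\<lambda>k. D (times_to t k))" using times_to[OF assms(2)] by (rule LIMSEQ_imp_Cauchy)
    then obtain N where N: "\<And>k k'. k \<ge> N \<Longrightarrow> k' \<ge> N \<Longrightarrow> dist (D (times_to t k)) (D (times_to t k')) < 1 / Suc j"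
      using metric_CauchyD[of "\<lambda>k. D (times_to t k)" "1 / Suc j"] by auto
    have "dist (appr y (times_to t k) k) (appr y (times_to t k') k') < e"
      if "k \<ge> max j N" "k' \<ge> max j N" for k k'
      using j[of k k' "times_to t k" "times_to t k'"] N[of k k'] that l by (force simp: dist_real_def)
    then show "\<exists>M. \<forall>m\<ge>M. \<forall>n\<ge>M. dist (appr y (times_to t m) m) (appr y (times_to t n) n) < e" by blast
  qed
  then have "convergent (\<lambda>k. appr y (times_to t k) k)" by (rule Cauchy_convergent)
  then show ?thesis using assms by (simp add: decode_path_def convergent_LIMSEQ_iff)
qed

lemma decode_path_in: "decode_path y \<in> mspace (path_metric T)"
proof (cases "good y")
  case False
  then have "continuous_on {0..T} (decode_path y)"
    by (intro continuous_on_eq[OF continuous_on_const[of _ "x 0"]]) (simp add: decode_path_def)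
  then show ?thesis by (simp add: mspace_path_metric decode_path_def)
next
  case True
  have "continuous_on {0..T} (decode_path y)"
    unfolding continuous_on_iff
  proof (intro ballI allI impI)
    fix t e assume t: "t \<in> {0..T}" and "(e :: real) > 0"
    then obtain l where l: "1 / Suc l < e" using nat_approx_posE by auto
    obtain j where j: "\<And>k k' m m'. k \<ge> j \<Longrightarrow> k' \<ge> j \<Longrightarrow> \<bar>D m - D m'\<bar> < 1 / Suc j \<Longrightarrow>
        dist (appr y m k) (appr y m' k') \<le> 1 / Suc l"
      using True unfolding good_def by blast
    have "dist (decode_path y s) (decode_path y t) < e" if s: "s \<in> {0..T}" "dist s t < 1 / Suc j" for s
    proof -
      have "(\<lambda>k. dist (D (times_to s k)) (D (times_to t k))) \<longlonglongrightarrow> dist s t"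
        using times_to s t by (intro tendsto_dist) auto
      then have "\<forall>\<^sub>F k in sequentially. dist (D (times_to s k)) (D (times_to t k)) < 1 / Suc j"
        using s(2) by (rule order_tendstoD)
      then have "\<forall>\<^sub>F k in sequentially. dist (appr y (times_to s k) k) (appr y (times_to t k) k) \<le> 1 / Suc l"
        using eventually_ge_at_top[of j] by eventually_elim (rule j, auto simp: dist_real_def)
      then have "dist (decode_path y s) (decode_path y t) \<le> 1 / Suc l"
        using decode_path_LIMSEQ[OF True] s t
        by (intro tendsto_upperbound[OF tendsto_dist]) auto
      then show ?thesis using l by simp
    qed
    then show "\<exists>d>0. \<forall>x'\<in>{0..T}. dist x' t < d \<longrightarrow> dist (decode_path y x') (decode_path y t) < e"
      by (intro exI[of _ "1 / Suc j"]) auto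
  qed
  then show ?thesis by (simp add: mspace_path_metric decode_path_def)
qed

text \<open>This left inverse allows laws of paths to be moved to the line and back without loss. It
  holds because the approximation error \<open>1 / Suc k\<close> vanishes and
  \<open>\<gamma>\<close> is continuous along \<open>times_to t\<close>.\<close>

lemma decode_code_path:
  assumes \<gamma>: "\<gamma> \<in> mspace (path_metric T)"
  shows "decode_path (code_path \<gamma>) = \<gamma>"
proof
  fix t
  show "decode_path (code_path \<gamma>) t = \<gamma> t"
  proof (cases "t \<in> {0..T}")
    case False
    then show ?thesis using \<gamma> by (auto simp: decode_path_def mspace_path_metric extensional_def)
  next
    case True
    have "(\<lambda>k. \<gamma> (D (times_to t k))) \<longlonglongrightarrow> \<gamma> t"
      using \<gamma> True D_in times_to[OF True]
      by (intro continuous_on_tendsto_compose[of "{0..T}" \<gamma>]) (auto simp: mspace_path_metric)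
    then have "(\<lambda>k. dist (\<gamma> (D (times_to t k))) (\<gamma> t) + 1 / real (Suc k)) \<longlonglongrightarrow> 0 + 0"
      by (intro tendsto_add LIMSEQ_Suc[OF lim_1_over_n]) (simp add: tendsto_dist_iff[symmetric])
    then have "(\<lambda>k. dist (appr (code_path \<gamma>) (times_to t k) k) (\<gamma> t)) \<longlonglongrightarrow> 0"
    proof (rule tendsto_sandwich[rotated 3, OF tendsto_eq_rhs])
      show "\<forall>\<^sub>F k in sequentially. dist (appr (code_path \<gamma>) (times_to t k) k) (\<gamma> t)
          \<le> dist (\<gamma> (D (times_to t k))) (\<gamma> t) + 1 / real (Suc k)"
      proof (intro always_eventually allI)
        fix k
        show "dist (appr (code_path \<gamma>) (times_to t k) k) (\<gamma> t)
          \<le> dist (\<gamma> (D (times_to t k))) (\<gamma> t) + 1 / real (Suc k)"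
          using appr_code_path[of \<gamma> "times_to t k" k]
            dist_triangle[of "appr (code_path \<gamma>) (times_to t k) k" "\<gamma> t" "\<gamma> (D (times_to t k))"] by linarith
      qed
    qed auto
    then have "(\<lambda>k. appr (code_path \<gamma>) (times_to t k) k) \<longlonglongrightarrow> \<gamma> t"
      by (simp add: tendsto_dist_iff[symmetric])
    then show ?thesis
      using decode_path_LIMSEQ[OF good_code_path[OF \<gamma>] True] LIMSEQ_unique by blast
  qed
qed

lemma measurable_decode_path: "decode_path \<in> borel \<rightarrow>\<^sub>M path_borel T"
proof (rule measurable_path_borelI[where D = "range D", OF T])
  fix t assume "t \<in> range D"
  then have t: "t \<in> {0..T}" using D_in by auto
  show "(\<lambda>y. decode_path y t) \<in> borel_measurable borel"
  proof (rule borel_measurable_LIMSEQ_metric)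
    show "(\<lambda>y. if good y then appr y (times_to t k) k else x 0) \<in> borel_measurable borel" for k
      by measurable
    show "(\<lambda>k. if good y then appr y (times_to t k) k else x 0) \<longlonglongrightarrow> decode_path y t" for y
      using decode_path_LIMSEQ[OF _ t, of y] t by (cases "good y") (simp_all add: decode_path_def)
  qed
qed (use D_in D_dense decode_path_in in auto)

text \<open>Convergence of the codes freezes, for each ball \<open>cell i k\<close>, whether
  \<open>g n (D m)\<close> belongs to it. A small cell around the subsequential limit
  \<open>y\<close> is entered by the subsequence, hence the whole sequence eventually stays in
  it.\<close>

lemma convergent_code_path_imp_LIMSEQ:
  assumes conv: "convergent (\<lambda>n. code_path (g n))"
    and r: "strict_mono r" and lim: "(\<lambda>n. g (r n) (D m)) \<longlonglongrightarrow> y"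
  shows "(\<lambda>n. g n (D m)) \<longlonglongrightarrow> y"
proof (rule metric_LIMSEQ_I)
  fix e :: real assume "e > 0"
  then obtain k where k: "1 / Suc k < e / 2" using nat_approx_posE[of "e / 2"] by auto
  obtain i where i: "x i \<in> ball y (1 / Suc k)"
    using x_dense[of "ball y (1 / Suc k)"] by auto
  obtain N where N: "\<And>n. n \<ge> N \<Longrightarrow> g n (D m) \<in> cell i k \<longleftrightarrow> g N (D m) \<in> cell i k"
    using ternary_digits_eventually_constant[OF conv[unfolded code_path_def],
        of "prod_encode (m, prod_encode (i, k))"] by auto
  have "open (cell i k)" "y \<in> cell i k" using i by (auto simp: cell_def dist_commute)
  then have "\<forall>\<^sub>F n in sequentially. g (r n) (D m) \<in> cell i k" using lim topological_tendstoD by blast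
  then obtain n where "n \<ge> N" "g (r n) (D m) \<in> cell i k"
    using eventually_ge_at_top[of N] eventually_happens'[OF sequentially_bot eventually_conj] by blast
  then have "g N (D m) \<in> cell i k" using N[of "r n"] strict_mono_imp_increasing[OF r, of n] by simp
  then have "dist (g n (D m)) y < e" if "n \<ge> N" for n
    using N[OF that] i k dist_triangle2[of "g n (D m)" y "x i"] by (auto simp: cell_def dist_commute)
  then show "\<exists>no. \<forall>n\<ge>no. dist (g n (D m)) y < e" by blast
qed

end

subsection \<open>Existence of minimising lifts\<close>

lemma borel_measure_eqI_closed:
  fixes M N :: "'a::topological_space measure"
  assumes sets: "sets M = sets borel" "sets N = sets borel"
    and fin: "emeasure M (space M) \<noteq> \<infinity>"
    and eq: "\<And>S. closed S \<Longrightarrow> emeasure M S = emeasure N S"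
  shows "M = N"
proof (rule measure_eqI_generator_eq[where E = "Collect closed" and \<Omega> = UNIV and A = "\<lambda>_. UNIV"])
  show "Int_stable (Collect closed :: 'a set set)" by (auto simp: Int_stable_def)
  show "sets M = sigma_sets UNIV (Collect closed)" "sets N = sigma_sets UNIV (Collect closed)"
    using sets by (simp_all add: borel_eq_closed)
  show "emeasure M UNIV \<noteq> \<infinity>" for i :: nat
    using fin sets_eq_imp_space_eq[OF sets(1)] by simp
qed (use eq in auto)

text \<open>Dominated convergence equates the integrals of bounded continuous functions, and these
  determine a law. It serves twice to identify the marginals of a limit path: along the coupled
  sequence at a dense time, then along dense times that approach an arbitrary one.\<close>

lemma distr_eq_of_LIMSEQ:
  fixes X :: "nat \<Rightarrow> 'b \<Rightarrow> 'a::metric_space" and Y :: "nat \<Rightarrow> 'c \<Rightarrow> 'a"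
  assumes P: "prob_space P" and Q: "prob_space Q"
    and [measurable]: "\<And>n. X n \<in> borel_measurable P" "\<And>n. Y n \<in> borel_measurable Q"
      "X' \<in> borel_measurable P" "Y' \<in> borel_measurable Q"
    and eq: "\<And>n. distr P borel (X n) = distr Q borel (Y n)"
    and X: "AE \<omega> in P. (\<lambda>n. X n \<omega>) \<longlonglongrightarrow> X' \<omega>" and Y: "AE \<omega> in Q. (\<lambda>n. Y n \<omega>) \<longlonglongrightarrow> Y' \<omega>"
  shows "distr P borel X' = distr Q borel Y'"
proof -
  interpret P: prob_space P by fact
  interpret Q: prob_space Q by fact
  have int_eq: "(\<integral>\<omega>. f (X' \<omega>) \<partial>P) = (\<integral>\<omega>. f (Y' \<omega>) \<partial>Q)"
    if cont: "continuous_on UNIV f" and bd: "\<And>x. \<bar>f x\<bar> \<le> 1" for f :: "'a \<Rightarrow> real"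
  proof -
    have [measurable]: "f \<in> borel_measurable borel" using cont by (rule borel_measurable_continuous_onI)
    have "(\<lambda>n. \<integral>\<omega>. f (X n \<omega>) \<partial>P) \<longlonglongrightarrow> (\<integral>\<omega>. f (X' \<omega>) \<partial>P)"
      using X bd continuous_on_tendsto_compose[OF cont]
      by (intro integral_dominated_convergence[where w = "\<lambda>_. 1"]) (auto elim!: eventually_mono)
    moreover have "(\<lambda>n. \<integral>\<omega>. f (Y n \<omega>) \<partial>Q) \<longlonglongrightarrow> (\<integral>\<omega>. f (Y' \<omega>) \<partial>Q)"
      using Y bd continuous_on_tendsto_compose[OF cont]
      by (intro integral_dominated_convergence[where w = "\<lambda>_. 1"]) (auto elim!: eventually_mono)
    moreover have "(\<integral>\<omega>. f (X n \<omega>) \<partial>P) = (\<integral>\<omega>. f (Y n \<omega>) \<partial>Q)" for n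
    proof -
      have "(\<integral>\<omega>. f (X n \<omega>) \<partial>P) = (\<integral>x. f x \<partial>distr P borel (X n))" by (rule integral_distr[symmetric]) auto
      also have "\<dots> = (\<integral>\<omega>. f (Y n \<omega>) \<partial>Q)" unfolding eq by (rule integral_distr) auto
      finally show ?thesis .
    qed
    ultimately show ?thesis using LIMSEQ_unique by simp
  qed
  show ?thesis
  proof (rule borel_measure_eqI_closed)
    fix S :: "'a set" assume S: "closed S"
    then have [measurable]: "S \<in> sets borel" by simp
    show "emeasure (distr P borel X') S = emeasure (distr Q borel Y') S"
    \<comment> \<open>\<open>infdist\<close> to the empty set is zero, so the cutoffs used for
      nonempty \<open>S\<close> would be constantly one here.\<close>
    proof (cases "S = {}")
      case False
      \<comment> \<open>Continuous cutoffs that decrease to the indicator of the closed set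
        \<open>S\<close>.\<close>
      define f where "f k x = max 0 (1 - real k * infdist x S)" for k x
      have bd: "0 \<le> f k x" "f k x \<le> 1" for k x by (auto simp: f_def infdist_nonneg)
      have cont: "continuous_on UNIV (f k)" for k
        unfolding f_def by (intro continuous_intros continuous_on_infdist)
      have [measurable]: "f k \<in> borel_measurable borel" for k
        using cont by (rule borel_measurable_continuous_onI)
      have lim: "(\<lambda>k. f k x) \<longlonglongrightarrow> indicator S x" for x
      proof (cases "x \<in> S")
        case True
        then show ?thesis by (simp add: f_def)
      next
        case outside: False
        then have pos: "infdist x S > 0"
          using S False by (metis in_closed_iff_infdist_zero infdist_nonneg less_le)
        obtain N :: nat where N: "1 < real N * infdist x S" using reals_Archimedean3[OF pos] by blast
        have "f k x = 0" if "k \<ge> N" for k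
        proof -
          have "real N * infdist x S \<le> real k * infdist x S" using that pos by simp
          then show ?thesis using N by (simp add: f_def)
        qed
        then have "\<forall>\<^sub>F k in sequentially. f k x = indicator S x"
          using outside by (auto simp: eventually_sequentially)
        then show ?thesis by (rule tendsto_eventually)
      qed
      have "(\<lambda>k. \<integral>\<omega>. f k (X' \<omega>) \<partial>P) \<longlonglongrightarrow> (\<integral>\<omega>. indicator S (X' \<omega>) \<partial>P)"
        using bd lim by (intro integral_dominated_convergence[where w = "\<lambda>_. 1"]) auto
      moreover have "(\<lambda>k. \<integral>\<omega>. f k (Y' \<omega>) \<partial>Q) \<longlonglongrightarrow> (\<integral>\<omega>. indicator S (Y' \<omega>) \<partial>Q)"
        using bd lim by (intro integral_dominated_convergence[where w = "\<lambda>_. 1"]) auto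
      moreover have "(\<integral>\<omega>. f k (X' \<omega>) \<partial>P) = (\<integral>\<omega>. f k (Y' \<omega>) \<partial>Q)" for k
        using bd by (intro int_eq cont) auto
      ultimately have "(\<integral>\<omega>. indicator S (X' \<omega>) \<partial>P) = (\<integral>\<omega>. indicator S (Y' \<omega>) \<partial>Q :: real)"
        using LIMSEQ_unique by simp
      moreover have "(\<integral>\<omega>. indicator S (X' \<omega>) \<partial>P) = measure (distr P borel X') S"
        using integral_distr[of X' P borel "indicator S :: 'a \<Rightarrow> real"] by simp
      moreover have "(\<integral>\<omega>. indicator S (Y' \<omega>) \<partial>Q) = measure (distr Q borel Y') S"
        using integral_distr[of Y' Q borel "indicator S :: 'a \<Rightarrow> real"] by simp
      ultimately have meq: "measure (distr P borel X') S = measure (distr Q borel Y') S" by simp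
      interpret P': prob_space "distr P borel X'" by (rule P.prob_space_distr) simp
      interpret Q': prob_space "distr Q borel Y'" by (rule Q.prob_space_distr) simp
      show ?thesis by (simp add: meq P'.emeasure_eq_measure Q'.emeasure_eq_measure)
    qed simp
  next
    show "emeasure (distr P borel X') (space (distr P borel X')) \<noteq> \<infinity>"
      by (simp add: emeasure_distr P.emeasure_space_1)
  qed auto
qed

text \<open>\<open>equi\<close> controls the oscillation and \<open>start\<close> the position at
  time zero; with the Heine-Borel property they confine the values of a sublevel to a compact set.
  \<open>lsc\<close> refers to pointwise convergence, the mode in which limit paths are
  found.\<close>

locale path_energy = path_coding T D x
  for T :: real and D :: "nat \<Rightarrow> real" and x :: "nat \<Rightarrow> 'a::{polish_space, heine_borel}" +
  fixes F :: "(real \<Rightarrow> 'a) \<Rightarrow> ennreal" and x0 :: 'a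
  assumes measurable_F [measurable]: "F \<in> borel_measurable (path_borel T)"
    and lsc: "\<And>g \<gamma>. (\<And>n. g n \<in> mspace (path_metric T)) \<Longrightarrow> \<gamma> \<in> mspace (path_metric T) \<Longrightarrow>
      (\<And>t. t \<in> {0..T} \<Longrightarrow> (\<lambda>n. g n t) \<longlonglongrightarrow> \<gamma> t) \<Longrightarrow> F \<gamma> \<le> liminf (\<lambda>n. F (g n))"
    and equi: "\<And>C e. C < \<infinity> \<Longrightarrow> 0 < e \<Longrightarrow> \<exists>d>0. \<forall>\<gamma>\<in>mspace (path_metric T). F \<gamma> \<le> C \<longrightarrow>
      (\<forall>s\<in>{0..T}. \<forall>t\<in>{0..T}. dist s t < d \<longrightarrow> dist (\<gamma> s) (\<gamma> t) < e)"
    and start: "\<And>C. C < \<infinity> \<Longrightarrow> \<exists>R. \<forall>\<gamma>\<in>mspace (path_metric T). F \<gamma> \<le> C \<longrightarrow> dist (\<gamma> 0) x0 \<le> R"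
begin

text \<open>The way from \<open>0\<close> to \<open>t\<close> is cut into \<open>N\<close> steps
  shorter than the common modulus for oscillation one, with \<open>N\<close> depending only on
  \<open>T\<close> and \<open>d\<close>. Each step adds at most one to the distance from
  \<open>x0\<close>.\<close>

lemma bounded_sublevel:
  assumes C: "C < \<infinity>"
  shows "\<exists>R. \<forall>\<gamma>\<in>mspace (path_metric T). F \<gamma> \<le> C \<longrightarrow> (\<forall>t\<in>{0..T}. dist (\<gamma> t) x0 \<le> R)"
proof -
  obtain R where R: "\<And>\<gamma>. \<gamma> \<in> mspace (path_metric T) \<Longrightarrow> F \<gamma> \<le> C \<Longrightarrow> dist (\<gamma> 0) x0 \<le> R"
    using start[OF C] by blast
  obtain d where d: "d > 0" "\<And>\<gamma> s t. \<gamma> \<in> mspace (path_metric T) \<Longrightarrow> F \<gamma> \<le> C \<Longrightarrow>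
      s \<in> {0..T} \<Longrightarrow> t \<in> {0..T} \<Longrightarrow> dist s t < d \<Longrightarrow> dist (\<gamma> s) (\<gamma> t) < 1"
    using equi[OF C zero_less_one] by metis
  obtain N :: nat where N: "T < real N * d" using reals_Archimedean3[OF d(1)] by blast
  have "N > 0" using N T by (cases N) auto
  have "dist (\<gamma> t) x0 \<le> R + N" if \<gamma>: "\<gamma> \<in> mspace (path_metric T)" "F \<gamma> \<le> C" and t: "t \<in> {0..T}" for \<gamma> t
  proof -
    have in_T: "real k * t / N \<in> {0..T}" if "k \<le> N" for k
    proof -
      have "real k * t \<le> real N * T" using that t by (intro mult_mono) auto
      then show ?thesis using t \<open>N > 0\<close> by (simp add: pos_divide_le_eq mult.commute)
    qed
    have "dist (\<gamma> (real k * t / N)) x0 \<le> R + k" if "k \<le> N" for k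
      using that
    proof (induction k)
      case 0
      then show ?case using R[OF \<gamma>] by simp
    next
      case (Suc k)
      have "dist (real (Suc k) * t / N) (real k * t / N) = t / N"
        using t by (simp add: dist_real_def add_divide_distrib[symmetric] diff_divide_distrib[symmetric] algebra_simps)
      also have "t / N < d" using t N \<open>N > 0\<close> by (simp add: pos_divide_less_eq mult.commute)
      finally have "dist (\<gamma> (real (Suc k) * t / N)) (\<gamma> (real k * t / N)) < 1"
        using Suc.prems by (intro d(2)[OF \<gamma>] in_T) auto
      then show ?case
        using Suc dist_triangle[of "\<gamma> (real (Suc k) * t / N)" x0 "\<gamma> (real k * t / N)"] by simp
    qed
    from this[of N] show ?thesis using \<open>N > 0\<close> by simp
  qed
  then show ?thesis by blast
qed

text \<open>
  Compactness for a single realisation of the coupling: convergence of the codes replaces the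
  diagonal argument of the Arzela-Ascoli theorem.
\<close>

lemma code_convergent_limit_path:
  assumes g: "\<And>n. g n \<in> mspace (path_metric T)"
    and conv: "convergent (\<lambda>n. code_path (g n))" and fin: "liminf (\<lambda>n. F (g n)) < \<infinity>"
  shows "\<exists>\<gamma>\<in>mspace (path_metric T). (\<forall>m. (\<lambda>n. g n (D m)) \<longlonglongrightarrow> \<gamma> (D m)) \<and> F \<gamma> \<le> liminf (\<lambda>n. F (g n))"
proof -
  obtain r0 where r0: "strict_mono r0" "((\<lambda>n. F (g n)) \<circ> r0) \<longlonglongrightarrow> liminf (\<lambda>n. F (g n))"
    using liminf_subseq_lim by blast
  obtain C where C: "liminf (\<lambda>n. F (g n)) < C" "C < \<infinity>" using fin dense by blast
  obtain N where N: "\<And>n. n \<ge> N \<Longrightarrow> F (g (r0 n)) < C"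
    using order_tendstoD(2)[OF r0(2) C(1)] by (auto simp: eventually_sequentially)
  \<comment> \<open>Dropping the first \<open>N\<close> terms puts every \<open>g (r n)\<close> into
    one sublevel of \<open>F\<close>.\<close>
  define r where "r n = r0 (n + N)" for n
  have r: "strict_mono r" using r0(1) by (auto simp: r_def strict_mono_def)
  have Flim: "(\<lambda>n. F (g (r n))) \<longlonglongrightarrow> liminf (\<lambda>n. F (g n))"
    using LIMSEQ_ignore_initial_segment[OF r0(2), of N] by (simp add: r_def o_def)
  have FC: "F (g (r n)) \<le> C" for n using N[of "n + N"] by (simp add: r_def less_imp_le)
  \<comment> \<open>The energy is bounded only along \<open>r\<close>, yet the limit is along all
    \<open>n\<close>: the codes pass convergence on to the full sequence.\<close>
  have "\<exists>z. (\<lambda>n. g n (D m)) \<longlonglongrightarrow> z" for m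
  proof -
    obtain R where R: "\<And>n. dist (g (r n) (D m)) x0 \<le> R"
      using bounded_sublevel[OF C(2)] g FC D_in by blast
    have "bounded (range (\<lambda>n. g (r n) (D m)))"
      unfolding bounded_any_center[of _ x0] using R by (intro exI[of _ R]) (auto simp: dist_commute)
    then obtain z s where "strict_mono s" "((\<lambda>n. g (r n) (D m)) \<circ> s) \<longlonglongrightarrow> z"
      using bounded_imp_convergent_subsequence by blast
    then have "(\<lambda>n. g n (D m)) \<longlonglongrightarrow> z"
      using r by (intro convergent_code_path_imp_LIMSEQ[OF conv, of "r \<circ> s"]) (auto simp: o_def strict_mono_def)
    then show ?thesis by blast
  qed
  then obtain z where z: "\<And>m. (\<lambda>n. g n (D m)) \<longlonglongrightarrow> z m" by metis
  \<comment> \<open>Equicontinuity along \<open>r\<close> spreads convergence from the dense times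
    to all times.\<close>
  have "convergent (\<lambda>n. g (r n) t)" if t: "t \<in> {0..T}" for t
  proof (rule Cauchy_convergent, rule metric_CauchyI)
    fix e :: real assume "e > 0"
    then have e3: "e / 3 > 0" by simp
    obtain d where d: "d > 0" "\<And>n s t. s \<in> {0..T} \<Longrightarrow> t \<in> {0..T} \<Longrightarrow> dist s t < d \<Longrightarrow>
        dist (g (r n) s) (g (r n) t) < e / 3"
      using equi[OF C(2) e3] g FC by metis
    have "t \<in> closure (range D)" using t D_dense by blast
    then obtain m where m: "dist (D m) t < d"
      using d(1) by (auto simp: closure_approachable)
    have "Cauchy (\<lambda>n. g (r n) (D m))"
      using LIMSEQ_subseq_LIMSEQ[OF z r, of m] by (intro LIMSEQ_imp_Cauchy) (simp add: o_def)
    then obtain N where N: "\<And>k l. k \<ge> N \<Longrightarrow> l \<ge> N \<Longrightarrow> dist (g (r k) (D m)) (g (r l) (D m)) < e / 3"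
      using metric_CauchyD[OF _ e3] by blast
    have "dist (g (r k) t) (g (r l) t) < e" if "k \<ge> N" "l \<ge> N" for k l
      using d(2)[OF D_in t m, of k] d(2)[OF D_in t m, of l] N[OF that]
        dist_triangle[of "g (r k) t" "g (r l) t" "g (r k) (D m)"]
        dist_triangle[of "g (r k) (D m)" "g (r l) t" "g (r l) (D m)"]
      by (simp add: dist_commute)
    then show "\<exists>M. \<forall>k\<ge>M. \<forall>l\<ge>M. dist (g (r k) t) (g (r l) t) < e" by blast
  qed
  then obtain \<gamma>' where \<gamma>': "\<And>t. t \<in> {0..T} \<Longrightarrow> (\<lambda>n. g (r n) t) \<longlonglongrightarrow> \<gamma>' t"
    unfolding convergent_def by metis
  define \<gamma> where "\<gamma> = restrict \<gamma>' {0..T}"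
  have \<gamma>: "(\<lambda>n. g (r n) t) \<longlonglongrightarrow> \<gamma> t" if "t \<in> {0..T}" for t
    using \<gamma>' that by (simp add: \<gamma>_def)
  have "continuous_on {0..T} \<gamma>"
    unfolding continuous_on_iff
  proof (intro ballI allI impI)
    fix t e assume t: "t \<in> {0..T}" and "(e :: real) > 0"
    then have e2: "e / 2 > 0" by simp
    obtain d where d: "d > 0" "\<And>n s t. s \<in> {0..T} \<Longrightarrow> t \<in> {0..T} \<Longrightarrow> dist s t < d \<Longrightarrow>
        dist (g (r n) s) (g (r n) t) < e / 2"
      using equi[OF C(2) e2] g FC by metis
    have "dist (\<gamma> s) (\<gamma> t) < e" if s: "s \<in> {0..T}" "dist s t < d" for s
    proof -
      have "dist (\<gamma> s) (\<gamma> t) \<le> e / 2"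
        using d(2)[OF s(1) t s(2)]
        by (intro tendsto_upperbound[OF tendsto_dist[OF \<gamma>[OF s(1)] \<gamma>[OF t]]]) (auto intro!: always_eventually less_imp_le)
      then show ?thesis using \<open>e > 0\<close> by simp
    qed
    then show "\<exists>d>0. \<forall>s\<in>{0..T}. dist s t < d \<longrightarrow> dist (\<gamma> s) (\<gamma> t) < e" using d(1) by blast
  qed
  then have \<gamma>_in: "\<gamma> \<in> mspace (path_metric T)" by (simp add: mspace_path_metric \<gamma>_def)
  moreover have "(\<lambda>n. g n (D m)) \<longlonglongrightarrow> \<gamma> (D m)" for m
    using z[of m] LIMSEQ_unique[OF LIMSEQ_subseq_LIMSEQ[OF z r, of m]] \<gamma>[OF D_in, of m] by (simp add: o_def)
  moreover have "F \<gamma> \<le> liminf (\<lambda>n. F (g n))"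
  proof -
    have "F \<gamma> \<le> liminf (\<lambda>n. F (g (r n)))" using g \<gamma>_in \<gamma> by (intro lsc) auto
    also have "\<dots> = liminf (\<lambda>n. F (g n))"
      using Flim by (intro lim_imp_Liminf) auto
    finally show ?thesis .
  qed
  ultimately show ?thesis by blast
qed

end

section \<open>Couplings of lifts and their limits\<close>

lemma liftsD:
  assumes "\<pi> \<in> lifts T \<mu>"
  shows "prob_space \<pi>" "sets \<pi> = sets (path_borel T)" "space \<pi> = mspace (path_metric T)"
    and "\<And>t. t \<in> {0..T} \<Longrightarrow> distr \<pi> borel (\<lambda>\<gamma>. \<gamma> t) = \<mu> t"
proof -
  have *: "prob_space \<pi>" "sets \<pi> = sets (path_borel T)"
    using assms by (auto simp: lifts_def space_prob_algebra)
  then show "prob_space \<pi>" "sets \<pi> = sets (path_borel T)" by auto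
  show "space \<pi> = mspace (path_metric T)"
    using sets_eq_imp_space_eq[OF *(2)] by (simp add: space_path_borel)
  show "\<And>t. t \<in> {0..T} \<Longrightarrow> distr \<pi> borel (\<lambda>\<gamma>. \<gamma> t) = \<mu> t"
    using assms by (auto simp: lifts_def)
qed

lemma liftsI:
  assumes "prob_space \<pi>" "sets \<pi> = sets (path_borel T)"
    and "\<And>t. t \<in> {0..T} \<Longrightarrow> distr \<pi> borel (\<lambda>\<gamma>. \<gamma> t) = \<mu> t"
  shows "\<pi> \<in> lifts T \<mu>"
  using assms by (auto simp: lifts_def space_prob_algebra)

text \<open>
  Helly's and Skorohod's theorems apply to the laws of the codes, which are measures on \<open>[0, 1]\<close>;
  decoding transports the coupling back to paths.
\<close>

lemma (in path_coding) code_coupling: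
  assumes \<pi>: "\<And>n. prob_space (\<pi> n)" "\<And>n. sets (\<pi> n) = sets (path_borel T)"
  obtains r :: "nat \<Rightarrow> nat" and \<Omega> :: "real measure" and g where
    "strict_mono r" "prob_space \<Omega>" "\<And>n. g n \<in> \<Omega> \<rightarrow>\<^sub>M path_borel T"
    "\<And>n. distr \<Omega> (path_borel T) (g n) = \<pi> (r n)"
    "AE \<omega> in \<Omega>. convergent (\<lambda>n. code_path (g n \<omega>))"
proof -
  have sp: "space (\<pi> n) = mspace (path_metric T)" for n
    using sets_eq_imp_space_eq[OF \<pi>(2)[of n]] by (simp add: space_path_borel)
  have code [measurable]: "code_path \<in> borel_measurable (\<pi> n)" for n
    using measurable_code_path \<pi>(2)[of n] by (simp cong: measurable_cong_sets)
  note measurable_code_path [measurable] measurable_decode_path [measurable]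
  define \<nu> where "\<nu> n = distr (\<pi> n) borel code_path" for n
  have \<nu>: "real_distribution (\<nu> n)" for n
    unfolding \<nu>_def using \<pi>(1) code by (rule prob_space.real_distribution_distr)
  \<comment> \<open>Tightness is tested on intervals open on the left, and a code may be zero; hence
    the left end \<open>-1\<close>.\<close>
  have "measure (\<nu> n) {-1<..1} = 1" for n
  proof -
    interpret prob_space "\<pi> n" by (rule \<pi>)
    have "code_path -` {-1<..1} \<inter> space (\<pi> n) = space (\<pi> n)"
    proof -
      have "-1 < code_path \<gamma> \<and> code_path \<gamma> \<le> 1" for \<gamma> using code_path_in[of \<gamma>] by auto
      then show ?thesis by auto
    qed
    then show ?thesis unfolding \<nu>_def using prob_space by (subst measure_distr) auto
  qed
  then have "tight \<nu>"
    unfolding tight_def using \<nu> by (intro conjI allI impI exI[of _ "-1"] exI[of _ 1]) simp_all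
  then obtain r M where r: "strict_mono r" "real_distribution M" "weak_conv_m (\<nu> \<circ> id \<circ> r) M"
    using tight_imp_convergent_subsubsequence[of \<nu> id] by (auto simp: strict_mono_id)
  obtain \<Omega> :: "real measure" and Y :: "nat \<Rightarrow> real \<Rightarrow> real" and Y' where
    \<Omega>: "prob_space \<Omega>" and Y: "\<And>n. Y n \<in> borel_measurable \<Omega>" "\<And>n. distr \<Omega> borel (Y n) = (\<nu> \<circ> id \<circ> r) n"
      "\<And>\<omega>. \<omega> \<in> space \<Omega> \<Longrightarrow> (\<lambda>n. Y n \<omega>) \<longlonglongrightarrow> Y' \<omega>"
  proof -
    have "real_distribution ((\<nu> \<circ> id \<circ> r) n)" for n using \<nu> by simp
    from Skorohod[OF this r(2,3)] show ?thesis using that by blast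
  qed
  note Y(1) [measurable]
  define g where "g n \<omega> = decode_path (Y n \<omega>)" for n \<omega>
  have g [measurable]: "g n \<in> \<Omega> \<rightarrow>\<^sub>M path_borel T" for n
    unfolding g_def by measurable
  have "distr \<Omega> (path_borel T) (g n) = \<pi> (r n)" for n
  proof -
    have "distr \<Omega> (path_borel T) (g n) = distr (distr \<Omega> borel (Y n)) (path_borel T) decode_path"
      by (subst distr_distr) (auto simp: g_def[abs_def] o_def)
    also have "\<dots> = distr (\<pi> (r n)) (path_borel T) (decode_path \<circ> code_path)"
      unfolding Y(2) \<nu>_def by (simp add: distr_distr)
    also have "\<dots> = distr (\<pi> (r n)) (\<pi> (r n)) (\<lambda>\<gamma>. \<gamma>)"
      using \<pi>(2) sp by (intro distr_cong) (auto simp: decode_code_path)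
    finally show ?thesis by simp
  qed
  moreover have "AE \<omega> in \<Omega>. convergent (\<lambda>n. code_path (g n \<omega>))"
  proof -
    \<comment> \<open>To be the code of a path is to be fixed by \<open>code_path\<close> after
      \<open>decode_path\<close>. This Borel condition holds almost surely for
      \<open>\<nu> (r n)\<close>, hence for \<open>Y n\<close>, which has that law; so the codes of
      \<open>g n\<close> are the convergent numbers \<open>Y n\<close>.\<close>
    have "AE \<omega> in \<Omega>. code_path (decode_path (Y n \<omega>)) = Y n \<omega>" for n
    proof -
      have "AE \<gamma> in \<pi> (r n). code_path (decode_path (code_path \<gamma>)) = code_path \<gamma>"
        using sp by (intro AE_I2) (simp add: decode_code_path)
      then have "AE y in \<nu> (r n). code_path (decode_path y) = y"
        unfolding \<nu>_def by (subst AE_distr_iff) auto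
      then have "AE y in distr \<Omega> borel (Y n). code_path (decode_path y) = y"
        unfolding Y(2) comp_def id_def .
      then show ?thesis by (subst (asm) AE_distr_iff) auto
    qed
    then have "AE \<omega> in \<Omega>. \<forall>n. code_path (decode_path (Y n \<omega>)) = Y n \<omega>"
      by (simp add: AE_all_countable)
    then show ?thesis
    proof (rule AE_mp, intro AE_I2 impI)
      fix \<omega> assume "\<omega> \<in> space \<Omega>" "\<forall>n. code_path (decode_path (Y n \<omega>)) = Y n \<omega>"
      then show "convergent (\<lambda>n. code_path (g n \<omega>))"
        using Y(3)[of \<omega>] by (auto simp: g_def convergent_def)
    qed
  qed
  ultimately show ?thesis using that[of r \<Omega> g] r(1) \<Omega> g by blast
qed

text \<open>The limit paths are picked by choice, one for each realisation. Measurability is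
  recovered from their values at the times \<open>D m\<close>, which are limits of the measurable
  \<open>g n \<omega> (D m)\<close>, by \<open>measurable_path_borelI\<close>.\<close>

lemma (in path_energy) coupling_limit_path:
  fixes \<Omega> :: "'b measure"
  assumes \<Omega>: "prob_space \<Omega>" and g [measurable]: "\<And>n. g n \<in> \<Omega> \<rightarrow>\<^sub>M path_borel T"
    and conv: "AE \<omega> in \<Omega>. convergent (\<lambda>n. code_path (g n \<omega>))"
    and fin: "liminf (\<lambda>n. \<integral>\<^sup>+ \<omega>. F (g n \<omega>) \<partial>\<Omega>) < \<infinity>"
  obtains h where "h \<in> \<Omega> \<rightarrow>\<^sub>M path_borel T"
    "\<And>m. AE \<omega> in \<Omega>. (\<lambda>n. g n \<omega> (D m)) \<longlonglongrightarrow> h \<omega> (D m)"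
    "(\<integral>\<^sup>+ \<omega>. F (h \<omega>) \<partial>\<Omega>) \<le> liminf (\<lambda>n. \<integral>\<^sup>+ \<omega>. F (g n \<omega>) \<partial>\<Omega>)"
proof -
  note measurable_code_path [measurable]
  have gC: "g n \<omega> \<in> mspace (path_metric T)" if "\<omega> \<in> space \<Omega>" for n \<omega>
    using measurable_space[OF g that] by (simp add: space_path_borel)
  have Fg [measurable]: "(\<lambda>\<omega>. F (g n \<omega>)) \<in> borel_measurable \<Omega>" for n by measurable
  have Fatou: "(\<integral>\<^sup>+ \<omega>. liminf (\<lambda>n. F (g n \<omega>)) \<partial>\<Omega>) \<le> liminf (\<lambda>n. \<integral>\<^sup>+ \<omega>. F (g n \<omega>) \<partial>\<Omega>)"
    by (rule nn_integral_liminf) simp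
  define ok where "ok \<omega> \<longleftrightarrow> convergent (\<lambda>n. code_path (g n \<omega>)) \<and> liminf (\<lambda>n. F (g n \<omega>)) < \<infinity>" for \<omega>
  have [measurable]: "Measurable.pred \<Omega> ok" 
  proof -
    \<comment> \<open>The Cauchy property does not mention the unknown limit, so its measurability
      can be derived directly.\<close>
    have "Measurable.pred \<Omega> (\<lambda>\<omega>. Cauchy (\<lambda>n. code_path (g n \<omega>)))" by measurable
    then show ?thesis unfolding ok_def Cauchy_convergent_iff[symmetric] by measurable
  qed
  have "AE \<omega> in \<Omega>. liminf (\<lambda>n. F (g n \<omega>)) \<noteq> \<infinity>"
    using Fatou fin by (intro nn_integral_noteq_infinite) auto
  then have ok_AE: "AE \<omega> in \<Omega>. ok \<omega>"
    using conv by eventually_elim (simp add: ok_def less_top)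
  have "\<exists>\<gamma>\<in>mspace (path_metric T). (\<forall>m. (\<lambda>n. g n \<omega> (D m)) \<longlonglongrightarrow> \<gamma> (D m)) \<and> F \<gamma> \<le> liminf (\<lambda>n. F (g n \<omega>))"
    if "\<omega> \<in> space \<Omega>" "ok \<omega>" for \<omega>
    using that gC by (intro code_convergent_limit_path) (auto simp: ok_def)
  then obtain h' where h': "\<And>\<omega>. \<omega> \<in> space \<Omega> \<Longrightarrow> ok \<omega> \<Longrightarrow> h' \<omega> \<in> mspace (path_metric T)"
      "\<And>\<omega> m. \<omega> \<in> space \<Omega> \<Longrightarrow> ok \<omega> \<Longrightarrow> (\<lambda>n. g n \<omega> (D m)) \<longlonglongrightarrow> h' \<omega> (D m)"
      "\<And>\<omega>. \<omega> \<in> space \<Omega> \<Longrightarrow> ok \<omega> \<Longrightarrow> F (h' \<omega>) \<le> liminf (\<lambda>n. F (g n \<omega>))"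
    by metis
  define h where "h \<omega> = (if ok \<omega> then h' \<omega> else restrict (\<lambda>_. x0) {0..T})" for \<omega>
  have const: "restrict (\<lambda>_. x0) {0..T} \<in> mspace (path_metric T)"
    using continuous_on_cong[THEN iffD1, OF refl _ continuous_on_const[of "{0..T}" x0]]
    by (auto simp: mspace_path_metric)
  have h: "h \<in> \<Omega> \<rightarrow>\<^sub>M path_borel T"
  proof (rule measurable_path_borelI[where D = "range D", OF T])
    show "h \<omega> \<in> mspace (path_metric T)" if "\<omega> \<in> space \<Omega>" for \<omega>
      using h'(1)[OF that] const by (auto simp: h_def)
    fix t assume "t \<in> range D"
    then obtain m where m: "t = D m" by blast
    have [measurable]: "(\<lambda>\<omega>. g n \<omega> (D m)) \<in> borel_measurable \<Omega>" for n
      by (rule measurable_compose[OF g measurable_eval_path[OF D_in]])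
    show "(\<lambda>\<omega>. h \<omega> t) \<in> borel_measurable \<Omega>"
    proof (rule borel_measurable_LIMSEQ_metric)
      show "(\<lambda>\<omega>. if ok \<omega> then g n \<omega> (D m) else x0) \<in> borel_measurable \<Omega>" for n by measurable
      show "(\<lambda>n. if ok \<omega> then g n \<omega> (D m) else x0) \<longlonglongrightarrow> h \<omega> t" if "\<omega> \<in> space \<Omega>" for \<omega>
        using h'(2)[OF that] D_in[of m] by (cases "ok \<omega>") (auto simp: h_def m)
    qed
  qed (use D_in D_dense in auto)
  moreover have "AE \<omega> in \<Omega>. (\<lambda>n. g n \<omega> (D m)) \<longlonglongrightarrow> h \<omega> (D m)" for m
    using ok_AE AE_space by eventually_elim (use h'(2) in \<open>simp add: h_def\<close>)
  moreover have "(\<integral>\<^sup>+ \<omega>. F (h \<omega>) \<partial>\<Omega>) \<le> liminf (\<lambda>n. \<integral>\<^sup>+ \<omega>. F (g n \<omega>) \<partial>\<Omega>)"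
  proof (rule order_trans[OF nn_integral_mono_AE Fatou])
    show "AE \<omega> in \<Omega>. F (h \<omega>) \<le> liminf (\<lambda>n. F (g n \<omega>))"
      using ok_AE AE_space by eventually_elim (use h'(3) in \<open>simp add: h_def\<close>)
  qed
  ultimately show ?thesis using that by blast
qed

text \<open>All \<open>\<pi> n\<close> share their marginals, so at a dense time the limit has the
  law prescribed by \<open>\<pi> 0\<close>. Any other time is a limit of dense times, and both
  \<open>h \<omega>\<close> and the paths under \<open>\<pi> 0\<close> are continuous.\<close>

lemma (in path_energy) lift_closed:
  assumes lifts: "\<And>n. \<pi> n \<in> lifts T \<mu>" and fin: "liminf (\<lambda>n. \<integral>\<^sup>+ \<gamma>. F \<gamma> \<partial>\<pi> n) < \<infinity>"
    and \<Omega>: "prob_space \<Omega>" and g: "\<And>n. g n \<in> \<Omega> \<rightarrow>\<^sub>M path_borel T"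
    and law: "\<And>n. distr \<Omega> (path_borel T) (g n) = \<pi> n"
    and conv: "AE \<omega> in \<Omega>. convergent (\<lambda>n. code_path (g n \<omega>))"
  shows "\<exists>\<pi>'\<in>lifts T \<mu>. (\<integral>\<^sup>+ \<gamma>. F \<gamma> \<partial>\<pi>') \<le> liminf (\<lambda>n. \<integral>\<^sup>+ \<gamma>. F \<gamma> \<partial>\<pi> n)"
proof -
  interpret \<Omega>: prob_space \<Omega> by fact
  have Fint: "(\<integral>\<^sup>+ \<omega>. F (g n \<omega>) \<partial>\<Omega>) = (\<integral>\<^sup>+ \<gamma>. F \<gamma> \<partial>\<pi> n)" for n
    unfolding law[symmetric] using g by (intro nn_integral_distr[symmetric]) auto
  have "liminf (\<lambda>n. \<integral>\<^sup>+ \<omega>. F (g n \<omega>) \<partial>\<Omega>) < \<infinity>" using fin by (simp only: Fint)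
  then obtain h where h: "h \<in> \<Omega> \<rightarrow>\<^sub>M path_borel T"
    "\<And>m. AE \<omega> in \<Omega>. (\<lambda>n. g n \<omega> (D m)) \<longlonglongrightarrow> h \<omega> (D m)"
    "(\<integral>\<^sup>+ \<omega>. F (h \<omega>) \<partial>\<Omega>) \<le> liminf (\<lambda>n. \<integral>\<^sup>+ \<omega>. F (g n \<omega>) \<partial>\<Omega>)"
    by (rule coupling_limit_path[OF \<Omega> g conv]) (rule that)
  have hev: "(\<lambda>\<omega>. h \<omega> t) \<in> borel_measurable \<Omega>" if "t \<in> {0..T}" for t
    by (rule measurable_compose[OF h(1) measurable_eval_path[OF that]])
  have gev: "(\<lambda>\<omega>. g n \<omega> t) \<in> borel_measurable \<Omega>" if "t \<in> {0..T}" for n t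
    by (rule measurable_compose[OF g measurable_eval_path[OF that]])
  have \<pi>ev: "(\<lambda>\<gamma>. \<gamma> t) \<in> borel_measurable (\<pi> n)" if "t \<in> {0..T}" for n t
    using measurable_eval_path[OF that] liftsD(2)[OF lifts] by (simp cong: measurable_cong_sets)
  have hC: "h \<omega> \<in> mspace (path_metric T)" if "\<omega> \<in> space \<Omega>" for \<omega>
    using measurable_space[OF h(1) that] by (simp add: space_path_borel)
  have margD: "distr \<Omega> borel (\<lambda>\<omega>. h \<omega> (D m)) = \<mu> (D m)" for m
  proof -
    have "distr \<Omega> borel (\<lambda>\<omega>. h \<omega> (D m)) = distr (\<pi> 0) borel (\<lambda>\<gamma>. \<gamma> (D m))"
    proof (rule distr_eq_of_LIMSEQ)
      show "distr \<Omega> borel (\<lambda>\<omega>. g n \<omega> (D m)) = distr (\<pi> 0) borel (\<lambda>\<gamma>. \<gamma> (D m))" for n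
      proof -
        have "distr \<Omega> borel (\<lambda>\<omega>. g n \<omega> (D m)) = distr (distr \<Omega> (path_borel T) (g n)) borel (\<lambda>\<gamma>. \<gamma> (D m))"
          using distr_distr[OF measurable_eval_path[OF D_in] g, of n m] by (simp add: o_def)
        then show ?thesis using liftsD(4)[OF lifts D_in] law by simp
      qed
    qed (use \<Omega> hev gev \<pi>ev D_in h(2) liftsD(1)[OF lifts] in auto)
    then show ?thesis using liftsD(4)[OF lifts D_in] by simp
  qed
  have marg: "distr \<Omega> borel (\<lambda>\<omega>. h \<omega> t) = \<mu> t" if t: "t \<in> {0..T}" for t
  proof -
    have lim: "(\<lambda>n. \<gamma> (D (times_to t n))) \<longlonglongrightarrow> \<gamma> t" if "\<gamma> \<in> mspace (path_metric T)" for \<gamma> :: "real \<Rightarrow> 'a"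
      using that t D_in times_to[OF t]
      by (intro continuous_on_tendsto_compose[of "{0..T}" \<gamma>]) (auto simp: mspace_path_metric)
    have "distr \<Omega> borel (\<lambda>\<omega>. h \<omega> t) = distr (\<pi> 0) borel (\<lambda>\<gamma>. \<gamma> t)"
    proof (rule distr_eq_of_LIMSEQ)
      show "distr \<Omega> borel (\<lambda>\<omega>. h \<omega> (D (times_to t n))) = distr (\<pi> 0) borel (\<lambda>\<gamma>. \<gamma> (D (times_to t n)))" for n
        using margD liftsD(4)[OF lifts D_in] by simp
      show "AE \<omega> in \<Omega>. (\<lambda>n. h \<omega> (D (times_to t n))) \<longlonglongrightarrow> h \<omega> t"
        using lim hC by (intro AE_I2) auto
      show "AE \<gamma> in \<pi> 0. (\<lambda>n. \<gamma> (D (times_to t n))) \<longlonglongrightarrow> \<gamma> t"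
        using lim liftsD(3)[OF lifts] by (intro AE_I2) auto
    qed (use \<Omega> hev \<pi>ev D_in t liftsD(1)[OF lifts] in auto)
    then show ?thesis using liftsD(4)[OF lifts t] by simp
  qed
  define \<pi>' where "\<pi>' = distr \<Omega> (path_borel T) h"
  have "\<pi>' \<in> lifts T \<mu>"
  proof (rule liftsI)
    show "prob_space \<pi>'" unfolding \<pi>'_def by (rule \<Omega>.prob_space_distr[OF h(1)])
    fix t assume t: "t \<in> {0..T}"
    show "distr \<pi>' borel (\<lambda>\<gamma>. \<gamma> t) = \<mu> t"
      unfolding \<pi>'_def using distr_distr[OF measurable_eval_path[OF t] h(1)] marg[OF t] by (simp add: o_def)
  qed (simp add: \<pi>'_def)
  moreover have "(\<integral>\<^sup>+ \<gamma>. F \<gamma> \<partial>\<pi>') = (\<integral>\<^sup>+ \<omega>. F (h \<omega>) \<partial>\<Omega>)"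
    unfolding \<pi>'_def using h(1) by (intro nn_integral_distr) auto
  ultimately show ?thesis using h(3) Fint by (intro bexI[of _ "\<pi>'"]) simp_all
qed

lemma (in path_energy) lift_minimizer_exists:
  assumes ne: "lifts T \<mu> \<noteq> {}"
  shows "\<exists>\<pi>\<in>lifts T \<mu>. \<forall>\<pi>'\<in>lifts T \<mu>. (\<integral>\<^sup>+ \<gamma>. F \<gamma> \<partial>\<pi>) \<le> (\<integral>\<^sup>+ \<gamma>. F \<gamma> \<partial>\<pi>')"
proof -
  define I where "I = (INF \<pi>\<in>lifts T \<mu>. \<integral>\<^sup>+ \<gamma>. F \<gamma> \<partial>\<pi>)"
  show ?thesis
  proof (cases "I = \<infinity>")
    case True
    then have "(\<integral>\<^sup>+ \<gamma>. F \<gamma> \<partial>\<pi>) = \<infinity>" if "\<pi> \<in> lifts T \<mu>" for \<pi>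
      using that INF_lower[OF that, of "\<lambda>\<pi>. \<integral>\<^sup>+ \<gamma>. F \<gamma> \<partial>\<pi>"] by (simp add: I_def top_unique)
    then show ?thesis using ne by auto
  next
    case False
    have "\<exists>\<pi>\<in>lifts T \<mu>. (\<integral>\<^sup>+ \<gamma>. F \<gamma> \<partial>\<pi>) < I + ennreal (1 / Suc n)" for n
    proof -
      have "I < I + ennreal (1 / Suc n)" using False
        by (cases I) (auto simp: ennreal_plus[symmetric] ennreal_less_iff simp del: ennreal_plus)
      then show ?thesis unfolding I_def INF_less_iff by simp
    qed
    then obtain \<pi> where \<pi>: "\<And>n. \<pi> n \<in> lifts T \<mu>" "\<And>n. (\<integral>\<^sup>+ \<gamma>. F \<gamma> \<partial>\<pi> n) < I + ennreal (1 / Suc n)"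
      by metis
    obtain r \<Omega> g where rg: "strict_mono r" "prob_space (\<Omega> :: real measure)" "\<And>n. g n \<in> \<Omega> \<rightarrow>\<^sub>M path_borel T"
        "\<And>n. distr \<Omega> (path_borel T) (g n) = \<pi> (r n)"
        "AE \<omega> in \<Omega>. convergent (\<lambda>n. code_path (g n \<omega>))"
      using code_coupling[of \<pi>] liftsD[OF \<pi>(1)] by metis
    have "(\<lambda>n. I + ennreal (1 / Suc n)) \<longlonglongrightarrow> I + ennreal 0"
      by (intro tendsto_add tendsto_const tendsto_ennrealI LIMSEQ_Suc[OF lim_1_over_n])
    from LIMSEQ_subseq_LIMSEQ[OF this rg(1)]
    have "liminf (\<lambda>n. I + ennreal (1 / Suc (r n))) = I"
      by (intro lim_imp_Liminf) (auto simp: o_def)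
    moreover have "liminf (\<lambda>n. \<integral>\<^sup>+ \<gamma>. F \<gamma> \<partial>\<pi> (r n)) \<le> liminf (\<lambda>n. I + ennreal (1 / Suc (r n)))"
      using \<pi>(2) by (intro Liminf_mono always_eventually allI less_imp_le)
    ultimately have le: "liminf (\<lambda>n. \<integral>\<^sup>+ \<gamma>. F \<gamma> \<partial>\<pi> (r n)) \<le> I" by simp
    moreover have "I < \<infinity>" using False by (simp add: less_top)
    ultimately obtain \<pi>' where "\<pi>' \<in> lifts T \<mu>" "(\<integral>\<^sup>+ \<gamma>. F \<gamma> \<partial>\<pi>') \<le> I"
      using lift_closed[where \<pi> = "\<lambda>n. \<pi> (r n)", OF \<pi>(1) _ rg(2-5)] by (meson order_trans le_less_trans)
    then show ?thesis unfolding I_def by (meson INF_lower order_trans)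
  qed
qed

subsection \<open>Energies of pairs of times\<close>

lemma ennreal_powr_ennreal: "0 \<le> x \<Longrightarrow> ennreal_powr (ennreal x) r = ennreal (x powr r)"
  by (simp add: ennreal_powr_def)

lemma ennreal_powr_inverse:
  assumes "r > 0" shows "ennreal_powr (ennreal_powr x (1 / r)) r = x"
  using assms by (cases x) (auto simp: ennreal_powr_def powr_powr)

lemma ennreal_powr_less_top: "ennreal_powr x r < \<infinity> \<longleftrightarrow> x < \<infinity>"
  by (auto simp: ennreal_powr_def less_top)

lemma liminf_add_le_ennreal:
  fixes u v :: "nat \<Rightarrow> ennreal"
  shows "liminf u + liminf v \<le> liminf (\<lambda>n. u n + v n)"
proof -
  have "liminf u + liminf v = (SUP n. INF m\<in>{n..}. u m) + (SUP n. INF m\<in>{n..}. v m)"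
    by (simp add: liminf_SUP_INF)
  also have "\<dots> = (SUP n. (INF m\<in>{n..}. u m) + (INF m\<in>{n..}. v m))"
    by (intro ennreal_SUP_add[symmetric]) (auto simp: incseq_def intro!: INF_superset_mono)
  also have "\<dots> \<le> (SUP n. INF m\<in>{n..}. u m + v m)"
    by (intro SUP_mono' INF_greatest add_mono INF_lower) auto
  finally show ?thesis by (simp add: liminf_SUP_INF)
qed

text \<open>The joint law of \<open>(\<gamma> s, \<gamma> t)\<close> under \<open>\<pi>\<close> is a
  coupling whose cost is the right-hand side.\<close>

lemma wasserstein_powr_le:
  fixes \<mu> :: "real \<Rightarrow> 'a::{metric_space, second_countable_topology} measure"
  assumes p: "p > 0" and \<pi>: "\<pi> \<in> lifts T \<mu>" and s: "s \<in> {0..T}" and t: "t \<in> {0..T}"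
  shows "ennreal_powr (wasserstein p (\<mu> s) (\<mu> t)) p \<le> (\<integral>\<^sup>+ \<gamma>. ennreal (dist (\<gamma> s) (\<gamma> t) powr p) \<partial>\<pi>)"
proof -
  interpret prob_space \<pi> by (rule liftsD[OF \<pi>])
  have ev [measurable]: "(\<lambda>\<gamma>. \<gamma> r) \<in> borel_measurable \<pi>" if "r \<in> {0..T}" for r
    using measurable_eval_path[OF that] liftsD(2)[OF \<pi>] by (simp cong: measurable_cong_sets)
  note [measurable] = ev[OF s] ev[OF t]
  define \<kappa> where "\<kappa> = distr \<pi> borel (\<lambda>\<gamma>. (\<gamma> s, \<gamma> t))"
  have "\<kappa> \<in> couplings (\<mu> s) (\<mu> t)"
  proof -
    have "prob_space \<kappa>" unfolding \<kappa>_def by (intro prob_space_distr) measurable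
    moreover have "distr \<kappa> borel fst = \<mu> s" "distr \<kappa> borel snd = \<mu> t"
      unfolding \<kappa>_def using liftsD(4)[OF \<pi>] s t
      by (subst distr_distr; simp add: o_def borel_measurable_continuous_onI continuous_on_fst continuous_on_snd)+
    ultimately show ?thesis by (simp add: couplings_def space_prob_algebra \<kappa>_def)
  qed
  then have "(INF \<kappa>\<in>couplings (\<mu> s) (\<mu> t). \<integral>\<^sup>+ z. ennreal (dist (fst z) (snd z) powr p) \<partial>\<kappa>)
      \<le> (\<integral>\<^sup>+ z. ennreal (dist (fst z) (snd z) powr p) \<partial>\<kappa>)"
    by (rule INF_lower)
  also have "\<dots> = (\<integral>\<^sup>+ \<gamma>. ennreal (dist (\<gamma> s) (\<gamma> t) powr p) \<partial>\<pi>)"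
  proof -
    have [measurable]: "(\<lambda>z :: 'a \<times> 'a. dist (fst z) (snd z)) \<in> borel_measurable borel"
      by (intro borel_measurable_continuous_onI continuous_intros)
    show ?thesis unfolding \<kappa>_def by (subst nn_integral_distr) auto
  qed
  finally show ?thesis by (simp add: wasserstein_def ennreal_powr_inverse[OF p])
qed

text \<open>
  Both energies have the form \<open>\<integral> w(z) \<rho>(X\<^bsub>a(z)\<^esub>, X\<^bsub>b(z)\<^esub>)\<^sup>p dM(z)\<close>, with a product of Lebesgue measures
  or a counting measure as \<open>M\<close>.
\<close>

definition pair_energy ::
    "'z measure \<Rightarrow> ('z \<Rightarrow> real) \<Rightarrow> ('z \<Rightarrow> real) \<Rightarrow> ('z \<Rightarrow> real) \<Rightarrow> real \<Rightarrow>
      ('b \<Rightarrow> 'b \<Rightarrow> ennreal) \<Rightarrow> (real \<Rightarrow> 'b) \<Rightarrow> ennreal"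
  where "pair_energy M w a b p \<rho> X =
    (\<integral>\<^sup>+ z. ennreal (w z) * ennreal_powr (\<rho> (X (a z)) (X (b z))) p \<partial>M)"

lemma pair_energy_edist:
  "pair_energy M w a b p edist \<gamma> = (\<integral>\<^sup>+ z. ennreal (w z) * ennreal (dist (\<gamma> (a z)) (\<gamma> (b z)) powr p) \<partial>M)"
  by (simp add: pair_energy_def ennreal_powr_ennreal)

text \<open>Sigma-finiteness is there for Tonelli's theorem. \<open>ends\<close> is asked for every
  index, also where the weight vanishes; clamped times provide this in both instances.\<close>

locale pair_weight = sigma_finite_measure M
  for M :: "'z measure" +
  fixes w a b :: "'z \<Rightarrow> real" and p T :: real
  assumes measurable_weight [measurable]: "w \<in> borel_measurable M"
    and measurable_ends [measurable]: "a \<in> borel_measurable M" "b \<in> borel_measurable M"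
    and weight_nonneg: "\<And>z. 0 \<le> w z" and ends: "\<And>z. a z \<in> {0..T}" "\<And>z. b z \<in> {0..T}"
    and p: "0 < p" and T: "0 \<le> T"
begin

abbreviation energy :: "(real \<Rightarrow> 'a::{metric_space, second_countable_topology}) \<Rightarrow> ennreal"
  where "energy \<equiv> pair_energy M w a b p edist"

lemma measurable_pair_dist [measurable]:
  "(\<lambda>(\<gamma>, z). dist (\<gamma> (a z)) (\<gamma> (b z) :: 'a::{metric_space, second_countable_topology}))
    \<in> borel_measurable (path_borel T \<Otimes>\<^sub>M M)"
proof -
  have "(\<lambda>x. fst x (c (snd x))) \<in> path_borel T \<Otimes>\<^sub>M M \<rightarrow>\<^sub>M (borel :: 'a measure)"
    if [measurable]: "c \<in> borel_measurable M" and c: "\<And>z. c z \<in> {0..T}" for c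
  proof -
    have "(\<lambda>x. (fst x, c (snd x))) \<in> (path_borel T :: (real \<Rightarrow> 'a) measure) \<Otimes>\<^sub>M M \<rightarrow>\<^sub>M path_borel T \<Otimes>\<^sub>M borel"
      by measurable
    from measurable_compose[OF this measurable_eval_pair[OF T]] show ?thesis
      using c by (simp add: clamp_time_id)
  qed
  then have [measurable]: "(\<lambda>x. fst x (a (snd x))) \<in> path_borel T \<Otimes>\<^sub>M M \<rightarrow>\<^sub>M (borel :: 'a measure)"
    "(\<lambda>x. fst x (b (snd x))) \<in> path_borel T \<Otimes>\<^sub>M M \<rightarrow>\<^sub>M (borel :: 'a measure)"
    using ends by auto
  show ?thesis unfolding case_prod_beta by measurable
qed

lemma measurable_path_dist:
  fixes \<gamma> :: "real \<Rightarrow> 'a::{metric_space, second_countable_topology}"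
  assumes "\<gamma> \<in> mspace (path_metric T)"
  shows "(\<lambda>z. dist (\<gamma> (a z)) (\<gamma> (b z))) \<in> borel_measurable M"
  using measurable_compose[OF measurable_Pair1' measurable_pair_dist, of \<gamma>] assms
  by (simp add: space_path_borel)

lemma measurable_energy: "energy \<in> borel_measurable (path_borel T)"
proof -
  have "(\<lambda>(\<gamma>, z). ennreal (w z) * ennreal (dist (\<gamma> (a z)) (\<gamma> (b z) :: 'a::{metric_space, second_countable_topology}) powr p))
      \<in> borel_measurable (path_borel T \<Otimes>\<^sub>M M)"
    using measurable_pair_dist by (simp add: case_prod_beta)
  then show ?thesis
    unfolding pair_energy_edist by (intro borel_measurable_nn_integral) (simp add: case_prod_beta)
qed

text \<open>Fatou's lemma applies because the integrand converges at every pair of times: the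
  distance is continuous and \<open>p\<close> is positive.\<close>

lemma energy_lsc:
  assumes g: "\<And>n. g n \<in> mspace (path_metric T)"
    and lim: "\<And>t. t \<in> {0..T} \<Longrightarrow> (\<lambda>n. g n t) \<longlonglongrightarrow> \<gamma> t"
  shows "energy \<gamma> \<le> liminf (\<lambda>n. energy (g n))"
proof -
  have "(\<lambda>n. ennreal (w z) * ennreal (dist (g n (a z)) (g n (b z)) powr p))
      \<longlonglongrightarrow> ennreal (w z) * ennreal (dist (\<gamma> (a z)) (\<gamma> (b z)) powr p)" for z
    unfolding ennreal_mult[OF weight_nonneg powr_ge_zero, symmetric]
    using lim[OF ends(1)] lim[OF ends(2)] p
    by (intro tendsto_ennrealI tendsto_mult tendsto_const tendsto_powr2 tendsto_dist) auto
  then have "energy \<gamma> = (\<integral>\<^sup>+ z. liminf (\<lambda>n. ennreal (w z) * ennreal (dist (g n (a z)) (g n (b z)) powr p)) \<partial>M)"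
    unfolding pair_energy_edist by (intro nn_integral_cong lim_imp_Liminf[symmetric]) auto
  also have "\<dots> \<le> liminf (\<lambda>n. energy (g n))"
    unfolding pair_energy_edist
  proof (rule nn_integral_liminf)
    have "(\<lambda>z. ennreal (w z) * ennreal (f z powr p)) \<in> borel_measurable M"
      if [measurable]: "f \<in> borel_measurable M" for f :: "'z \<Rightarrow> real"
      by measurable
    from this[OF measurable_path_dist[OF g]]
    show "(\<lambda>z. ennreal (w z) * ennreal (dist (g n (a z)) (g n (b z)) powr p)) \<in> borel_measurable M" for n .
  qed
  finally show ?thesis .
qed

text \<open>The bound at each pair of times is integrated against the weight and the integrals are
  exchanged. The first comparison is monotonicity of the nonnegative integral, valid for arbitrary
  functions of the index.\<close>

lemma wasserstein_energy_le:
  fixes \<mu> :: "real \<Rightarrow> 'a::{metric_space, second_countable_topology} measure"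
  assumes \<pi>: "\<pi> \<in> lifts T \<mu>"
  shows "pair_energy M w a b p (wasserstein p) \<mu> \<le> (\<integral>\<^sup>+ \<gamma>. energy \<gamma> \<partial>\<pi>)"
proof -
  interpret \<pi>: prob_space \<pi> by (rule liftsD[OF \<pi>])
  interpret pair_sigma_finite \<pi> M by unfold_locales
  have sets [measurable_cong]: "sets \<pi> = sets (path_borel T)" by (rule liftsD[OF \<pi>])
  have ev: "(\<lambda>\<gamma>. \<gamma> r) \<in> borel_measurable \<pi>" if "r \<in> {0..T}" for r
    using measurable_eval_path[OF that] sets by (simp cong: measurable_cong_sets)
  have meas: "(\<lambda>(\<gamma>, z). dist (\<gamma> (a z)) (\<gamma> (b z))) \<in> borel_measurable (\<pi> \<Otimes>\<^sub>M M)"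
    using measurable_pair_dist measurable_cong_sets[OF sets_pair_measure_cong[OF sets refl] refl] by blast
  have "pair_energy M w a b p (wasserstein p) \<mu>
      \<le> (\<integral>\<^sup>+ z. ennreal (w z) * (\<integral>\<^sup>+ \<gamma>. ennreal (dist (\<gamma> (a z)) (\<gamma> (b z)) powr p) \<partial>\<pi>) \<partial>M)"
    unfolding pair_energy_def
    by (intro nn_integral_mono mult_left_mono wasserstein_powr_le[OF p \<pi>] ends) auto
  also have "\<dots> = (\<integral>\<^sup>+ z. (\<integral>\<^sup>+ \<gamma>. ennreal (w z) * ennreal (dist (\<gamma> (a z)) (\<gamma> (b z)) powr p) \<partial>\<pi>) \<partial>M)"
  proof (intro nn_integral_cong nn_integral_cmult[symmetric])
    fix z
    note [measurable] = ev[OF ends(1)[of z]] ev[OF ends(2)[of z]]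
    show "(\<lambda>\<gamma>. ennreal (dist (\<gamma> (a z)) (\<gamma> (b z)) powr p)) \<in> borel_measurable \<pi>" by measurable
  qed
  also have "\<dots> = (\<integral>\<^sup>+ \<gamma>. (\<integral>\<^sup>+ z. ennreal (w z) * ennreal (dist (\<gamma> (a z)) (\<gamma> (b z)) powr p) \<partial>M) \<partial>\<pi>)"
    using meas by (intro Fubini') (simp add: case_prod_beta)
  finally show ?thesis by (simp add: pair_energy_edist)
qed

text \<open>The energy alone vanishes on constant paths and so does not confine them; the added term
  at time zero does. Its integral is the same constant \<open>K\<close> for every lift, so both
  functionals have the same minimisers.\<close>

lemma energy_minimizer_exists:
  fixes \<mu> :: "real \<Rightarrow> 'a::{polish_space, heine_borel} measure"
  assumes equi: "\<And>C e. C < \<infinity> \<Longrightarrow> 0 < e \<Longrightarrow> \<exists>d>0. \<forall>\<gamma>\<in>mspace (path_metric T :: (real \<Rightarrow> 'a) metric). energy \<gamma> \<le> C \<longrightarrow>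
      (\<forall>s\<in>{0..T}. \<forall>t\<in>{0..T}. dist s t < d \<longrightarrow> dist (\<gamma> s) (\<gamma> t) < e)"
    and moment: "\<mu> 0 \<in> finite_moment_probs p" and ne: "lifts T \<mu> \<noteq> {}"
  shows "\<exists>\<pi>\<in>lifts T \<mu>. \<forall>\<pi>'\<in>lifts T \<mu>. (\<integral>\<^sup>+ \<gamma>. energy \<gamma> \<partial>\<pi>) \<le> (\<integral>\<^sup>+ \<gamma>. energy \<gamma> \<partial>\<pi>')"
proof -
  obtain x0 where x0: "(\<integral>\<^sup>+ x. ennreal (dist x x0 powr p) \<partial>\<mu> 0) < \<infinity>"
    using moment by (auto simp: finite_moment_probs_def)
  have zero: "0 \<in> {0..T}" using T by simp
  obtain D' where D': "countable D'" "D' \<subseteq> {0..T}" "{0..T} \<subseteq> closure D'"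
    using separable[of "{0..T}"] by blast
  have D'_ne: "D' \<noteq> {}" using D'(3) zero by auto
  define D where "D = from_nat_into D'"
  have range_D: "range D = D'" unfolding D_def using D'_ne D'(1) by (rule range_from_nat_into)
  obtain Q :: "'a set" where Q: "countable Q" "\<And>U. open U \<Longrightarrow> U \<noteq> {} \<Longrightarrow> \<exists>y\<in>Q. y \<in> U"
    using countable_dense_setE by blast
  have "Q \<noteq> {}" using Q(2)[of UNIV] by auto
  then have range_Q: "range (from_nat_into Q) = Q" using Q(1) by (rule range_from_nat_into)
  define F where "F \<gamma> = ennreal (dist (\<gamma> 0) x0 powr p) + energy \<gamma>" for \<gamma> :: "real \<Rightarrow> 'a"
  note [measurable] = measurable_eval_path[OF zero] measurable_energy
  have F_meas: "F \<in> borel_measurable (path_borel T)" unfolding F_def by measurable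
  interpret path_energy T D "from_nat_into Q" F x0
  proof
    show "D m \<in> {0..T}" for m using D'(2) unfolding range_D[symmetric] by blast
    show "{0..T} \<subseteq> closure (range D)" using range_D D'(3) by simp
    show "\<exists>i. from_nat_into Q i \<in> U" if "open U" "U \<noteq> {}" for U
      using Q(2)[OF that] range_Q by (metis rangeE)
    fix g :: "nat \<Rightarrow> real \<Rightarrow> 'a" and \<gamma>
    assume g: "\<And>n. g n \<in> mspace (path_metric T)" and lim: "\<And>t. t \<in> {0..T} \<Longrightarrow> (\<lambda>n. g n t) \<longlonglongrightarrow> \<gamma> t"
    have "(\<lambda>n. ennreal (dist (g n 0) x0 powr p)) \<longlonglongrightarrow> ennreal (dist (\<gamma> 0) x0 powr p)"
      using lim[OF zero] p by (intro tendsto_ennrealI tendsto_powr2 tendsto_dist tendsto_const) auto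
    then have "ennreal (dist (\<gamma> 0) x0 powr p) = liminf (\<lambda>n. ennreal (dist (g n 0) x0 powr p))"
      by (intro lim_imp_Liminf[symmetric]) auto
    then have "F \<gamma> \<le> liminf (\<lambda>n. ennreal (dist (g n 0) x0 powr p)) + liminf (\<lambda>n. energy (g n))"
      using energy_lsc[OF g lim] by (simp add: F_def add_left_mono)
    also have "\<dots> \<le> liminf (\<lambda>n. F (g n))" unfolding F_def by (rule liminf_add_le_ennreal)
    finally show "F \<gamma> \<le> liminf (\<lambda>n. F (g n))" .
  next
    fix C :: ennreal and e :: real assume "C < \<infinity>" "0 < e"
    then show "\<exists>d>0. \<forall>\<gamma>\<in>mspace (path_metric T). F \<gamma> \<le> C \<longrightarrow>
        (\<forall>s\<in>{0..T}. \<forall>t\<in>{0..T}. dist s t < d \<longrightarrow> dist (\<gamma> s) (\<gamma> t) < e)"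
    proof -
      have "energy \<gamma> \<le> C" if "F \<gamma> \<le> C" for \<gamma>
        by (rule order_trans[OF _ that]) (simp add: F_def)
      with equi[OF \<open>C < \<infinity>\<close> \<open>0 < e\<close>] show ?thesis by blast
    qed
  next
    fix C :: ennreal assume C: "C < \<infinity>"
    have "dist (\<gamma> 0) x0 \<le> enn2real C powr (1 / p)" if "F \<gamma> \<le> C" for \<gamma>
    proof -
      have "ennreal (dist (\<gamma> 0) x0 powr p) \<le> C"
        by (rule order_trans[OF _ that]) (simp add: F_def)
      then have "dist (\<gamma> 0) x0 powr p \<le> enn2real C"
        using C by (cases C) auto
      then have "(dist (\<gamma> 0) x0 powr p) powr (1 / p) \<le> enn2real C powr (1 / p)"
        using p by (intro powr_mono2) auto
      then show ?thesis using p by (simp add: powr_powr)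
    qed
    then show "\<exists>R. \<forall>\<gamma>\<in>mspace (path_metric T). F \<gamma> \<le> C \<longrightarrow> dist (\<gamma> 0) x0 \<le> R" by blast
  qed (use T F_meas in auto)
  define K where "K = (\<integral>\<^sup>+ x. ennreal (dist x x0 powr p) \<partial>\<mu> 0)"
  have F_int: "(\<integral>\<^sup>+ \<gamma>. F \<gamma> \<partial>\<pi>) = K + (\<integral>\<^sup>+ \<gamma>. energy \<gamma> \<partial>\<pi>)" if \<pi>: "\<pi> \<in> lifts T \<mu>" for \<pi>
  proof -
    note [measurable_cong] = liftsD(2)[OF \<pi>]
    have [measurable]: "(\<lambda>\<gamma>. \<gamma> 0) \<in> borel_measurable \<pi>" by measurable
    have "K = (\<integral>\<^sup>+ x. ennreal (dist x x0 powr p) \<partial>distr \<pi> borel (\<lambda>\<gamma>. \<gamma> 0))"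
      unfolding K_def liftsD(4)[OF \<pi> zero] ..
    also have "\<dots> = (\<integral>\<^sup>+ \<gamma>. ennreal (dist (\<gamma> 0) x0 powr p) \<partial>\<pi>)"
      by (rule nn_integral_distr) auto
    finally show ?thesis unfolding F_def by (simp add: nn_integral_add)
  qed
  obtain \<pi> where \<pi>: "\<pi> \<in> lifts T \<mu>" "\<And>\<pi>'. \<pi>' \<in> lifts T \<mu> \<Longrightarrow> (\<integral>\<^sup>+ \<gamma>. F \<gamma> \<partial>\<pi>) \<le> (\<integral>\<^sup>+ \<gamma>. F \<gamma> \<partial>\<pi>')"
    using lift_minimizer_exists[OF ne] by blast
  \<comment> \<open>\<open>K\<close> can be cancelled on both sides because it is finite.\<close>
  have "(\<integral>\<^sup>+ \<gamma>. energy \<gamma> \<partial>\<pi>) \<le> (\<integral>\<^sup>+ \<gamma>. energy \<gamma> \<partial>\<pi>')" if "\<pi>' \<in> lifts T \<mu>" for \<pi>'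
    using \<pi>(2)[OF that] x0 unfolding F_int[OF \<pi>(1)] F_int[OF that] K_def[symmetric]
    by (auto simp: ennreal_add_left_cancel_le)
  then show ?thesis using \<pi>(1) by blast
qed

end

subsection \<open>Equicontinuity of energy sublevels\<close>

text \<open>Origin of the constant: the dyadic points of level \<open>m\<close> just below
  \<open>s\<close> and \<open>t\<close> are equal or adjacent, which costs \<open>K * q ^ m\<close>;
  passing from them to \<open>s\<close> and to \<open>t\<close> costs a geometric tail
  \<open>K * q ^ m / (1 - q)\<close> each.\<close>

lemma dyadic_chaining:
  fixes \<gamma> :: "real \<Rightarrow> 'a::metric_space"
  assumes cont: "continuous_on {0..1} \<gamma>" and K: "0 \<le> K" and q: "0 \<le> q" "q < 1"
    and step: "\<And>m k. k < 2 ^ m \<Longrightarrow> dist (\<gamma> (real k / 2 ^ m)) (\<gamma> (real (k + 1) / 2 ^ m)) \<le> K * q ^ m"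
    and s: "s \<in> {0..1}" and t: "t \<in> {0..1}" and st: "dist s t < 1 / 2 ^ m"
  shows "dist (\<gamma> s) (\<gamma> t) \<le> K * q ^ m * (1 + 2 / (1 - q))"
proof -
  define j where "j n t = nat \<lfloor>2 ^ n * t\<rfloor>" for n :: nat and t :: real
  define fl where "fl n t = real (j n t) / 2 ^ n" for n t
  have j: "real (j n t) \<le> 2 ^ n * t" "2 ^ n * t < real (j n t) + 1" if "t \<in> {0..1}" for n t
  proof -
    have "real (j n t) = of_int \<lfloor>2 ^ n * t\<rfloor>" using that by (simp add: j_def)
    then show "real (j n t) \<le> 2 ^ n * t" "2 ^ n * t < real (j n t) + 1" by linarith+
  qed
  have fl_le: "fl n t \<le> t" "0 \<le> fl n t" if "t \<in> {0..1}" for n t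
    using j(1)[OF that, of n] by (simp_all add: fl_def pos_divide_le_eq mult.commute)
  have refine: "dist (\<gamma> (fl n t)) (\<gamma> (fl (Suc n) t)) \<le> K * q ^ Suc n" if t: "t \<in> {0..1}" for n t
  proof -
    \<comment> \<open>Refinement either keeps the rounded time or moves it by one step of level
      \<open>Suc n\<close>.\<close>
    have "real (j (Suc n) t) < real (2 * j n t + 2)" "real (2 * j n t) < real (j (Suc n) t + 1)"
      using j[OF t, of n] j[OF t, of "Suc n"] by simp_all
    then consider "j (Suc n) t = 2 * j n t" | "j (Suc n) t = 2 * j n t + 1" by linarith
    then show ?thesis
    proof cases
      case 1
      then show ?thesis using K q by (simp add: fl_def)
    next
      case 2
      have "real (2 * j n t + 1) \<le> 2 ^ Suc n * t" using j(1)[OF t, of "Suc n"] unfolding 2 .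
      also have "\<dots> \<le> 2 ^ Suc n * 1" using t by (intro mult_left_mono) auto
      finally have "real (2 * j n t + 1) \<le> real (2 ^ Suc n)" by simp
      then have "2 * j n t + 1 \<le> 2 ^ Suc n" by (simp only: of_nat_le_iff)
      then have "2 * j n t < 2 ^ Suc n" by simp
      then have "dist (\<gamma> (real (2 * j n t) / 2 ^ Suc n)) (\<gamma> (real (2 * j n t + 1) / 2 ^ Suc n)) \<le> K * q ^ Suc n"
        by (rule step)
      then show ?thesis by (simp add: fl_def 2)
    qed
  qed
  have tail: "dist (\<gamma> (fl m t)) (\<gamma> t) \<le> K * q ^ m / (1 - q)" if t: "t \<in> {0..1}" for t
  proof -
    have part: "dist (\<gamma> (fl m t)) (\<gamma> (fl (m + n) t)) \<le> K * q ^ m * ((1 - q ^ n) / (1 - q))" for n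
    proof (induction n)
      case (Suc n)
      have "dist (\<gamma> (fl m t)) (\<gamma> (fl (m + Suc n) t))
          \<le> K * q ^ m * ((1 - q ^ n) / (1 - q)) + K * q ^ Suc (m + n)"
        using Suc refine[OF t, of "m + n"] dist_triangle[of "\<gamma> (fl m t)" "\<gamma> (fl (m + Suc n) t)" "\<gamma> (fl (m + n) t)"]
        by simp
      \<comment> \<open>Giving away one factor \<open>q\<close> turns the partial sum into a
        geometric sum from exponent zero.\<close>
      also have "K * q ^ Suc (m + n) \<le> K * q ^ (m + n)"
        using K q by (intro mult_left_mono power_decreasing) auto
      also have "K * q ^ m * ((1 - q ^ n) / (1 - q)) + K * q ^ (m + n) = K * q ^ m * ((1 - q ^ n) / (1 - q) + q ^ n)"
        by (simp add: power_add algebra_simps)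
      also have "(1 - q ^ n) / (1 - q) + q ^ n = (1 - q ^ Suc n) / (1 - q)"
        using q by (simp add: field_simps)
      finally show ?case by simp
    qed simp
    have bound: "dist (\<gamma> (fl m t)) (\<gamma> (fl (m + n) t)) \<le> K * q ^ m / (1 - q)" for n
    proof -
      have "(1 - q ^ n) / (1 - q) \<le> 1 / (1 - q)" using q by (intro divide_right_mono) auto
      then have "K * q ^ m * ((1 - q ^ n) / (1 - q)) \<le> K * q ^ m * (1 / (1 - q))"
        using K q by (intro mult_left_mono) auto
      then show ?thesis using part[of n] by simp
    qed
    have "(\<lambda>n. fl n t) \<longlonglongrightarrow> t"
      using floor_dyadic_LIMSEQ[of t] t by (simp add: fl_def j_def)
    then have "(\<lambda>n. fl (m + n) t) \<longlonglongrightarrow> t"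
      using LIMSEQ_ignore_initial_segment[of "\<lambda>n. fl n t" t m] by (simp add: add.commute)
    then have "(\<lambda>n. \<gamma> (fl (m + n) t)) \<longlonglongrightarrow> \<gamma> t"
      using fl_le[OF t] t order_trans[OF fl_le(1)[OF t]]
      by (intro continuous_on_tendsto_compose[OF cont]) (auto intro!: always_eventually)
    then show ?thesis
      using bound by (intro tendsto_upperbound[OF tendsto_dist[OF tendsto_const]]) auto
  qed
  have near: "dist (\<gamma> (fl m s)) (\<gamma> (fl m t)) \<le> K * q ^ m"
    if s: "s \<in> {0..1}" and t: "t \<in> {0..1}" and st: "dist s t < 1 / 2 ^ m" and le: "j m s \<le> j m t" for s t
  proof -
    \<comment> \<open>Times closer than the mesh have equal or adjacent rounded indices.\<close>
    have "2 ^ m * t - 2 ^ m * s < 1"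
    proof -
      have "(t - s) * 2 ^ m < 1" using st by (simp add: dist_real_def pos_less_divide_eq[symmetric])
      then show ?thesis by (simp add: algebra_simps)
    qed
    then have "real (j m t) < real (j m s + 2)" using j[OF s, of m] j[OF t, of m] by simp
    then consider "j m t = j m s" | "j m t = j m s + 1" using le by linarith
    then show ?thesis
    proof cases
      case 1
      then show ?thesis using K q by (simp add: fl_def)
    next
      case 2
      have "real (j m s + 1) \<le> 2 ^ m * t" using j(1)[OF t, of m] unfolding 2 .
      also have "\<dots> \<le> 2 ^ m * 1" using t by (intro mult_left_mono) auto
      finally have "real (j m s + 1) \<le> real (2 ^ m)" by simp
      then have "j m s + 1 \<le> 2 ^ m" by (simp only: of_nat_le_iff)
      then show ?thesis using step[of "j m s" m] by (simp add: fl_def 2)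
    qed
  qed
  have "dist (\<gamma> (fl m s)) (\<gamma> (fl m t)) \<le> K * q ^ m"
    using near[OF s t st] near[OF t s] st by (cases "j m s \<le> j m t") (auto simp: dist_commute)
  moreover have "K * q ^ m * (1 + 2 / (1 - q)) = K * q ^ m + K * q ^ m / (1 - q) + K * q ^ m / (1 - q)"
    by (simp add: algebra_simps)
  ultimately show ?thesis
    using tail[OF s] tail[OF t] dist_triangle3[of "\<gamma> s" "\<gamma> t" "\<gamma> (fl m t)"]
      dist_triangle[of "\<gamma> (fl m t)" "\<gamma> s" "\<gamma> (fl m s)"] dist_commute[of "\<gamma> (fl m t)" "\<gamma> (fl m s)"]
    by linarith
qed

section \<open>Averages over the unit interval and changes of variables\<close>

definition unit_uniform :: "real measure"
  where "unit_uniform = restrict_space lborel {0..1}"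

lemma space_unit_uniform [simp]: "space unit_uniform = {0..1}"
  by (simp add: unit_uniform_def space_restrict_space)

lemma emeasure_unit_uniform [simp]: "emeasure unit_uniform {0..1} = 1"
  by (simp add: unit_uniform_def emeasure_restrict_space)

lemma prob_space_unit_uniform: "prob_space unit_uniform"
  by (rule prob_spaceI) simp

lemma measurable_unit_uniform [measurable]: "(\<lambda>r. r) \<in> unit_uniform \<rightarrow>\<^sub>M borel"
  by (simp add: unit_uniform_def measurable_restrict_space1)

lemma nn_integral_unit_uniform:
  "(\<integral>\<^sup>+ r. f r \<partial>unit_uniform) = (\<integral>\<^sup>+ r. f r * indicator {0..1} r \<partial>lborel)"
  by (simp add: unit_uniform_def nn_integral_restrict_space)

lemma nn_integral_unit_uniform_le: "(\<integral>\<^sup>+ r. f r \<partial>unit_uniform) \<le> (\<integral>\<^sup>+ r. f r \<partial>lborel)"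
  unfolding nn_integral_unit_uniform by (intro nn_integral_mono) (auto split: split_indicator)

text \<open>This lets the segment from \<open>s\<close> to \<open>t\<close> be read from the end
  \<open>t\<close>.\<close>

lemma nn_integral_unit_uniform_reflect:
  assumes [measurable]: "f \<in> borel_measurable borel"
  shows "(\<integral>\<^sup>+ r. f (1 - r) \<partial>unit_uniform) = (\<integral>\<^sup>+ r. f r \<partial>unit_uniform)"
proof -
  have "(\<integral>\<^sup>+ r. f r * indicator {0..1} r \<partial>lborel)
      = ennreal \<bar>- 1\<bar> * (\<integral>\<^sup>+ r. f (1 + - 1 * r) * indicator {0..1} (1 + - 1 * r) \<partial>lborel)"
    by (rule nn_integral_real_affine) auto
  also have "\<dots> = (\<integral>\<^sup>+ r. f (1 - r) * indicator {0..1} r \<partial>lborel)"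
    by (auto intro!: nn_integral_cong split: split_indicator)
  finally show ?thesis by (simp add: nn_integral_unit_uniform)
qed

lemma nn_integral_lborel_pair_affine:
  fixes u v x y :: real
  assumes [measurable]: "H \<in> borel_measurable (lborel \<Otimes>\<^sub>M lborel)" and uv: "u \<noteq> 0" "v \<noteq> 0"
  shows "(\<integral>\<^sup>+ r. \<integral>\<^sup>+ r'. H (x + u * r, y + v * r') \<partial>lborel \<partial>lborel)
    = ennreal (1 / (\<bar>u\<bar> * \<bar>v\<bar>)) * (\<integral>\<^sup>+ z. H z \<partial>(lborel \<Otimes>\<^sub>M lborel))"
proof -
  have inner: "(\<integral>\<^sup>+ t. H (s, t) \<partial>lborel) = ennreal \<bar>v\<bar> * (\<integral>\<^sup>+ r'. H (s, y + v * r') \<partial>lborel)" for s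
    using uv by (intro nn_integral_real_affine) auto
  have "(\<integral>\<^sup>+ z. H z \<partial>(lborel \<Otimes>\<^sub>M lborel)) = (\<integral>\<^sup>+ s. \<integral>\<^sup>+ t. H (s, t) \<partial>lborel \<partial>lborel)"
    by (simp add: lborel.nn_integral_fst)
  also have "\<dots> = ennreal \<bar>u\<bar> * (\<integral>\<^sup>+ r. \<integral>\<^sup>+ t. H (x + u * r, t) \<partial>lborel \<partial>lborel)"
    using uv by (intro nn_integral_real_affine) (auto intro!: lborel.borel_measurable_nn_integral)
  also have "\<dots> = ennreal \<bar>u\<bar> * (ennreal \<bar>v\<bar> * (\<integral>\<^sup>+ r. \<integral>\<^sup>+ r'. H (x + u * r, y + v * r') \<partial>lborel \<partial>lborel))"
    unfolding inner by (subst nn_integral_cmult) auto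
  finally have eq: "(\<integral>\<^sup>+ z. H z \<partial>(lborel \<Otimes>\<^sub>M lborel))
      = ennreal (\<bar>u\<bar> * \<bar>v\<bar>) * (\<integral>\<^sup>+ r. \<integral>\<^sup>+ r'. H (x + u * r, y + v * r') \<partial>lborel \<partial>lborel)"
    by (simp add: ennreal_mult mult.assoc)
  have "ennreal (1 / (\<bar>u\<bar> * \<bar>v\<bar>)) * ennreal (\<bar>u\<bar> * \<bar>v\<bar>) = 1"
    using uv by (subst ennreal_mult[symmetric]) auto
  then show ?thesis unfolding eq mult.assoc[symmetric] by simp
qed

text \<open>The indicator of the square belongs to the weight, so that the index measure is Lebesgue
  measure on the whole plane and clamping the times changes nothing.\<close>

definition frac_weight :: "real \<Rightarrow> real \<Rightarrow> real \<Rightarrow> real \<times> real \<Rightarrow> real"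
  where "frac_weight \<alpha> p T z = indicator ({0..T} \<times> {0..T}) z / \<bar>snd z - fst z\<bar> powr (1 + \<alpha> * p)"

abbreviation frac_energy :: "real \<Rightarrow> real \<Rightarrow> real \<Rightarrow> ('b \<Rightarrow> 'b \<Rightarrow> ennreal) \<Rightarrow> (real \<Rightarrow> 'b) \<Rightarrow> ennreal"
  where "frac_energy \<alpha> p T \<equiv> pair_energy (lborel \<Otimes>\<^sub>M lborel) (frac_weight \<alpha> p T)
    (\<lambda>z. clamp_time T (fst z)) (\<lambda>z. clamp_time T (snd z)) p"

lemma pair_weight_frac:
  assumes "0 < p" "0 \<le> T"
  shows "pair_weight (lborel \<Otimes>\<^sub>M lborel) (frac_weight \<alpha> p T)
    (\<lambda>z. clamp_time T (fst z)) (\<lambda>z. clamp_time T (snd z)) p T"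
proof -
  interpret sigma_finite_measure "lborel \<Otimes>\<^sub>M lborel :: (real \<times> real) measure"
    unfolding lborel_prod by (rule lborel.sigma_finite_measure_axioms)
  have [measurable]: "frac_weight \<alpha> p T \<in> borel_measurable (lborel \<Otimes>\<^sub>M lborel)"
    unfolding frac_weight_def by measurable
  show ?thesis
  proof
    show "0 \<le> frac_weight \<alpha> p T z" for z by (simp add: frac_weight_def)
  qed (use assms clamp_time_in in auto)
qed

text \<open>
  Off the diagonal the two integrands agree; on it the weight is the junk value \<open>1 / 0 = 0\<close>, and
  the integrand of the seminorm is \<open>0 / 0 = 0\<close>.
\<close>

lemma frac_seminorm_powr:
  assumes p: "0 < p" and diag: "\<And>t. t \<in> {0..T} \<Longrightarrow> ennreal_powr (\<rho> (X t) (X t)) p = 0"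
  shows "ennreal_powr (frac_seminorm \<rho> \<alpha> p T X) p = frac_energy \<alpha> p T \<rho> X"
  unfolding frac_seminorm_def ennreal_powr_inverse[OF p] pair_energy_def
proof (intro nn_integral_cong)
  fix z :: "real \<times> real"
  obtain s t where z: "z = (s, t)" by (cases z)
  show "(case z of (s, t) \<Rightarrow> ennreal_powr (\<rho> (X s) (X t)) p / ennreal (\<bar>t - s\<bar> powr (1 + \<alpha> * p))) *
      indicator ({0..T} \<times> {0..T}) z
    = ennreal (frac_weight \<alpha> p T z) *
      ennreal_powr (\<rho> (X (clamp_time T (fst z))) (X (clamp_time T (snd z)))) p"
  proof (cases "s \<in> {0..T} \<and> t \<in> {0..T}")
    case True
    then have c: "clamp_time T s = s" "clamp_time T t = t" by (simp_all add: clamp_time_id)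
    show ?thesis
    proof (cases "s = t")
      case True
      then show ?thesis using diag[of t] \<open>s \<in> {0..T} \<and> t \<in> {0..T}\<close> by (simp add: z c frac_weight_def)
    next
      case False
      then have "\<bar>t - s\<bar> powr (1 + \<alpha> * p) > 0" by simp
      then have "inverse (ennreal (\<bar>t - s\<bar> powr (1 + \<alpha> * p))) = ennreal (frac_weight \<alpha> p T z)"
        using True by (simp add: z frac_weight_def inverse_ennreal inverse_eq_divide)
      then show ?thesis using True c by (simp add: z divide_ennreal_def mult.commute)
    qed
  qed (auto simp: z frac_weight_def)
qed

text \<open>Setting the weight to zero for \<open>k \<ge> 2 ^ m\<close> turns the triangular double
  sum into an integral over all pairs of naturals.\<close>

definition dyadic_weight :: "real \<Rightarrow> real \<Rightarrow> nat \<times> nat \<Rightarrow> real"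
  where "dyadic_weight \<alpha> p z = (if snd z < 2 ^ fst z then 2 powr (real (fst z) * (\<alpha> * p - 1)) else 0)"

abbreviation dyadic_energy :: "real \<Rightarrow> real \<Rightarrow> ('b \<Rightarrow> 'b \<Rightarrow> ennreal) \<Rightarrow> (real \<Rightarrow> 'b) \<Rightarrow> ennreal"
  where "dyadic_energy \<alpha> p \<equiv> pair_energy (count_space UNIV) (dyadic_weight \<alpha> p)
    (\<lambda>z. clamp_time 1 (real (snd z) / 2 ^ fst z)) (\<lambda>z. clamp_time 1 (real (snd z + 1) / 2 ^ fst z)) p"

lemma pair_weight_dyadic:
  assumes "0 < p"
  shows "pair_weight (count_space UNIV) (dyadic_weight \<alpha> p)
    (\<lambda>z. clamp_time 1 (real (snd z) / 2 ^ fst z)) (\<lambda>z. clamp_time 1 (real (snd z + 1) / 2 ^ fst z)) p 1"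
proof -
  interpret sigma_finite_measure "count_space UNIV :: (nat \<times> nat) measure"
    by (rule sigma_finite_measure_count_space)
  show ?thesis
  proof
    show "0 \<le> dyadic_weight \<alpha> p z" for z by (simp add: dyadic_weight_def)
  qed (use assms clamp_time_in in auto)
qed

lemma dyadic_time:
  assumes "k < 2 ^ m"
  shows "clamp_time 1 (real k / 2 ^ m) = real k / 2 ^ m" "clamp_time 1 (real (k + 1) / 2 ^ m) = real (k + 1) / 2 ^ m"
proof -
  have "real (k + 1) \<le> real (2 ^ m)" using assms by (simp only: of_nat_le_iff)
  then have "real (k + 1) \<le> 2 ^ m" by simp
  then show "clamp_time 1 (real k / 2 ^ m) = real k / 2 ^ m" "clamp_time 1 (real (k + 1) / 2 ^ m) = real (k + 1) / 2 ^ m"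
    using assms by (auto intro!: clamp_time_id)
qed

lemma dyadic_seminorm_powr:
  assumes p: "0 < p"
  shows "ennreal_powr (dyadic_seminorm \<rho> \<alpha> p X) p = dyadic_energy \<alpha> p \<rho> X"
proof -
  let ?f = "\<lambda>m k. ennreal_powr (\<rho> (X (real k / 2 ^ m)) (X (real (k + 1) / 2 ^ m))) p"
  have "dyadic_energy \<alpha> p \<rho> X = (\<integral>\<^sup>+ m. \<integral>\<^sup>+ k. ennreal (dyadic_weight \<alpha> p (m, k)) *
      ennreal_powr (\<rho> (X (clamp_time 1 (real k / 2 ^ m))) (X (clamp_time 1 (real (k + 1) / 2 ^ m)))) p
      \<partial>count_space UNIV \<partial>count_space UNIV)"
    unfolding pair_energy_def by (subst nn_integral_fst_count_space[symmetric]) simp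
  also have "\<dots> = (\<integral>\<^sup>+ m. ennreal (2 powr (real m * (\<alpha> * p - 1))) * (\<Sum>k<2 ^ m. ?f m k) \<partial>count_space UNIV)"
  proof (intro nn_integral_cong)
    fix m
    have "(\<integral>\<^sup>+ k. ennreal (dyadic_weight \<alpha> p (m, k)) *
        ennreal_powr (\<rho> (X (clamp_time 1 (real k / 2 ^ m))) (X (clamp_time 1 (real (k + 1) / 2 ^ m)))) p \<partial>count_space UNIV)
      = (\<integral>\<^sup>+ k. (ennreal (2 powr (real m * (\<alpha> * p - 1))) * ?f m k) * indicator {..<2 ^ m} k \<partial>count_space UNIV)"
      by (intro nn_integral_cong) (auto simp: dyadic_weight_def dyadic_time dyadic_time[simplified] split: split_indicator)
    also have "\<dots> = (\<integral>\<^sup>+ k. ennreal (2 powr (real m * (\<alpha> * p - 1))) * ?f m k \<partial>count_space {..<2 ^ m})"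
      by (subst nn_integral_count_space_indicator) auto
    also have "\<dots> = ennreal (2 powr (real m * (\<alpha> * p - 1))) * (\<Sum>k<2 ^ m. ?f m k)"
      by (simp add: nn_integral_count_space_finite sum_distrib_left)
    finally show "(\<integral>\<^sup>+ k. ennreal (dyadic_weight \<alpha> p (m, k)) *
        ennreal_powr (\<rho> (X (clamp_time 1 (real k / 2 ^ m))) (X (clamp_time 1 (real (k + 1) / 2 ^ m)))) p \<partial>count_space UNIV)
      = ennreal (2 powr (real m * (\<alpha> * p - 1))) * (\<Sum>k<2 ^ m. ?f m k)" .
  qed
  also have "\<dots> = (\<Sum>m. ennreal (2 powr (real m * (\<alpha> * p - 1))) * (\<Sum>k<2 ^ m. ?f m k))"
    by (rule nn_integral_count_space_nat)
  finally show ?thesis unfolding dyadic_seminorm_def ennreal_powr_inverse[OF p] by simp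
qed

text \<open>A single term of the sum is at most \<open>C\<close>; taking \<open>p\<close>-th roots
  gives steps of size at most \<open>K * q ^ n\<close> with \<open>K = C powr (1 / p)\<close> and
  \<open>q = 2 powr (- (\<alpha> - 1 / p))\<close>. Chaining applies because \<open>q < 1\<close>,
  that is \<open>1 / p < \<alpha>\<close>.\<close>

lemma dyadic_equicontinuous:
  fixes C :: ennreal
  assumes p: "0 < p" and \<alpha>: "1 / p < \<alpha>" and C: "C < \<infinity>" and e: "0 < e"
  shows "\<exists>d>0. \<forall>\<gamma>\<in>mspace (path_metric 1 :: (real \<Rightarrow> 'a::metric_space) metric). dyadic_energy \<alpha> p edist \<gamma> \<le> C \<longrightarrow>
    (\<forall>s\<in>{0..1}. \<forall>t\<in>{0..1}. dist s t < d \<longrightarrow> dist (\<gamma> s) (\<gamma> t) < e)"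
proof -
  define q :: real where "q = 2 powr (- (\<alpha> - 1 / p))"
  have q: "0 \<le> q" "q < 1" using \<alpha> by (auto simp: q_def powr_less_one)
  define K where "K = enn2real C powr (1 / p)"
  have K: "0 \<le> K" by (simp add: K_def)
  have "(\<lambda>m. K * q ^ m * (1 + 2 / (1 - q))) \<longlonglongrightarrow> K * 0 * (1 + 2 / (1 - q))"
    using q by (intro tendsto_intros LIMSEQ_power_zero) auto
  then have "\<forall>\<^sub>F m in sequentially. K * q ^ m * (1 + 2 / (1 - q)) < e"
    using e by (intro order_tendstoD) auto
  then obtain m where m: "K * q ^ m * (1 + 2 / (1 - q)) < e"
    using eventually_happens'[OF sequentially_bot] by blast
  have "dist (\<gamma> s) (\<gamma> t) < e"
    if \<gamma>: "\<gamma> \<in> mspace (path_metric 1)" "dyadic_energy \<alpha> p edist \<gamma> \<le> C"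
      and st: "s \<in> {0..1}" "t \<in> {0..1}" "dist s t < 1 / 2 ^ m" for \<gamma> :: "real \<Rightarrow> 'a" and s t
  proof -
    have "dist (\<gamma> (real k / 2 ^ n)) (\<gamma> (real (k + 1) / 2 ^ n)) \<le> K * q ^ n" if k: "k < 2 ^ n" for n k
    proof -
      let ?d = "dist (\<gamma> (real k / 2 ^ n)) (\<gamma> (real (k + 1) / 2 ^ n))" and ?w = "2 powr (real n * (\<alpha> * p - 1)) :: real"
      have "ennreal ?w * ennreal (?d powr p) \<le> dyadic_energy \<alpha> p edist \<gamma>"
        unfolding pair_energy_edist
        using nn_integral_ge_point[of "(n, k)" UNIV "\<lambda>z. ennreal (dyadic_weight \<alpha> p z) *
          ennreal (dist (\<gamma> (clamp_time 1 (real (snd z) / 2 ^ fst z))) (\<gamma> (clamp_time 1 (real (snd z + 1) / 2 ^ fst z))) powr p)"]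
        using dyadic_time[OF k] k by (simp add: dyadic_weight_def)
      then have "ennreal (?w * ?d powr p) \<le> C" using \<gamma>(2) by (simp add: ennreal_mult order_trans)
      then have le: "?w * ?d powr p \<le> enn2real C" using C by (cases C) auto
      have "?d = (?w powr (1 / p) * ?d) * 2 powr (- (real n * (\<alpha> - 1 / p)))"
      proof -
        have "real n * (\<alpha> * p - 1) * (1 / p) = real n * (\<alpha> - 1 / p)" using p by (simp add: field_simps)
        then show ?thesis by (simp add: powr_powr powr_add[symmetric])
      qed
      also have "?w powr (1 / p) * ?d = (?w * ?d powr p) powr (1 / p)"
        using p by (simp add: powr_mult powr_powr)
      also have "\<dots> \<le> K" unfolding K_def using le p by (intro powr_mono2) auto
      also have "2 powr (- (real n * (\<alpha> - 1 / p))) = q ^ n"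
        by (simp add: q_def powr_realpow[symmetric] powr_powr algebra_simps)
      finally show ?thesis by simp
    qed
    then have "dist (\<gamma> s) (\<gamma> t) \<le> K * q ^ m * (1 + 2 / (1 - q))"
      using \<gamma>(1) st by (intro dyadic_chaining[OF _ K q]) (auto simp: mspace_path_metric)
    then show ?thesis using m by simp
  qed
  then show ?thesis by (intro exI[of _ "1 / 2 ^ m"]) auto
qed

text \<open>Above the threshold \<open>l\<close>, write \<open>d = d powr (1 - p) * d powr p\<close>
  and use that the exponent \<open>1 - p\<close> is nonpositive. It stands in for Jensen's
  inequality: if the mean of \<open>d powr p\<close> is at most \<open>l powr p\<close>, the mean of
  \<open>d\<close> is at most \<open>2 * l\<close>.\<close>

lemma le_add_powr:
  fixes d l p :: real
  assumes "0 \<le> d" "0 < l" "1 \<le> p"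
  shows "d \<le> l + l powr (1 - p) * d powr p"
proof (cases "d \<le> l")
  case False
  then have "d powr (1 - p) * d powr p = d" using assms by (simp add: powr_add[symmetric])
  moreover have "d powr (1 - p) \<le> l powr (1 - p)" using False assms by (intro powr_mono2') auto
  ultimately have "d \<le> l powr (1 - p) * d powr p"
    by (metis mult_right_mono powr_ge_zero)
  then show ?thesis using assms by simp
qed (use assms in \<open>simp add: add_increasing2\<close>)

lemma segment_in:
  fixes x u r T :: real
  assumes "x \<in> {0..T}" "x + u \<in> {0..T}" "r \<in> {0..1}"
  shows "x + u * r \<in> {0..T}"
proof -
  have "x + u * r = (1 - r) * x + r * (x + u)" by (simp add: algebra_simps)
  moreover have "0 \<le> (1 - r) * x + r * (x + u)" using assms by auto
  moreover have "(1 - r) * x + r * (x + u) \<le> T" using assms by (intro convex_bound_le) auto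
  ultimately show ?thesis by simp
qed

text \<open>
  Instead of the Garsia-Rodemich-Rumsey inequality it suffices to compare the averages of \<open>d(\<gamma>\<^bsub>x\<^esub>, \<cdot>)\<close> over the
  intervals between \<open>x\<close> and \<open>x + u / 2\<^sup>n\<close> for consecutive \<open>n\<close>: the energy controls each difference by
  a geometric sequence, and the averages tend to \<open>0\<close> by continuity.
\<close>

locale frac_bounded_path =
  fixes \<alpha> p T C :: real and \<gamma> :: "real \<Rightarrow> 'a::{metric_space, second_countable_topology}"
  assumes p: "1 < p" and \<alpha>: "1 / p < \<alpha>" and T: "0 \<le> T" and C: "0 < C"
    and \<gamma>: "\<gamma> \<in> mspace (path_metric T)" and bound: "frac_energy \<alpha> p T edist \<gamma> \<le> ennreal C"
begin

definition path_ext :: "real \<Rightarrow> 'a"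
  where "path_ext t = \<gamma> (clamp_time T t)"

lemma measurable_path_ext [measurable]: "path_ext \<in> borel_measurable borel"
  unfolding path_ext_def by (rule borel_measurable_continuous_onI[OF continuous_path_clamp[OF T \<gamma>]])

text \<open>The parameter in \<open>{0..1}\<close> treats positive and negative \<open>u\<close>
  alike.\<close>

definition average :: "real \<Rightarrow> real \<Rightarrow> ennreal"
  where "average x u = (\<integral>\<^sup>+ r. edist (path_ext x) (path_ext (x + u * r)) \<partial>unit_uniform)"

text \<open>The \<open>p\<close>-th root of
  \<open>2 * C * \<bar>u\<bar> powr (\<alpha> * p - 1)\<close>, which is what the energy yields for
  the double average.\<close>

definition increment_bound :: "real \<Rightarrow> real"
  where "increment_bound u = (2 * C) powr (1 / p) * \<bar>u\<bar> powr (\<alpha> - 1 / p)"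

text \<open>Both points lie on the segment from \<open>x\<close> to \<open>x + u\<close>, so the
  kernel is at least \<open>\<bar>u\<bar> powr (- (1 + \<alpha> * p))\<close> off the diagonal. The
  change of variables contributes \<open>2 / \<bar>u\<bar> ^ 2\<close>, and the energy contributes
  \<open>C\<close>.\<close>

lemma double_average_le:
  assumes x: "x \<in> {0..T}" "x + u \<in> {0..T}" and u: "u \<noteq> 0"
  shows "(\<integral>\<^sup>+ r. \<integral>\<^sup>+ r'. ennreal (dist (path_ext (x + u * r)) (path_ext (x + u / 2 * r')) powr p) \<partial>unit_uniform \<partial>unit_uniform)
    \<le> ennreal (increment_bound u powr p)"
proof -
  have \<alpha>0: "\<alpha> > 0" using p \<alpha> by (meson divide_pos_pos less_trans zero_less_one)
  define H where "H z = ennreal (frac_weight \<alpha> p T z) * ennreal (dist (path_ext (fst z)) (path_ext (snd z)) powr p)" for z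
  have [measurable]: "H \<in> borel_measurable (lborel \<Otimes>\<^sub>M lborel)"
    unfolding H_def frac_weight_def by measurable
  have "(\<integral>\<^sup>+ z. H z \<partial>(lborel \<Otimes>\<^sub>M lborel)) \<le> ennreal C"
    using bound by (simp add: pair_energy_edist H_def path_ext_def)
  define c where "c = \<bar>u\<bar> powr (1 + \<alpha> * p)"
  \<comment> \<open>Coincident points need their own case: the weight there is the default
    \<open>1 / 0 = 0\<close>, but the left-hand side vanishes too.\<close>
  have pointwise: "ennreal (dist (path_ext (x + u * r)) (path_ext (x + u / 2 * r')) powr p)
      \<le> ennreal c * H (x + u * r, x + u / 2 * r')" if r: "r \<in> {0..1}" "r' \<in> {0..1}" for r r'
  proof (cases "x + u * r = x + u / 2 * r'")
    case False
    define w where "w = \<bar>x + u / 2 * r' - (x + u * r)\<bar>"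
    have w: "w > 0" using False by (simp add: w_def)
    have "w = \<bar>u\<bar> * \<bar>r' / 2 - r\<bar>" unfolding w_def abs_mult[symmetric] by (simp add: algebra_simps)
    also have "\<dots> \<le> \<bar>u\<bar> * 1" using r by (intro mult_left_mono) auto
    finally have "w powr (1 + \<alpha> * p) \<le> c" unfolding c_def using w p \<alpha>0 by (intro powr_mono2) auto
    then have "1 \<le> c * (1 / w powr (1 + \<alpha> * p))" using w by (simp add: pos_le_divide_eq)
    moreover have "frac_weight \<alpha> p T (x + u * r, x + u / 2 * r') = 1 / w powr (1 + \<alpha> * p)"
      using segment_in[OF x r(1)] segment_in[OF x, of "r' / 2"] r by (simp add: frac_weight_def w_def)
    ultimately have "dist (path_ext (x + u * r)) (path_ext (x + u / 2 * r')) powr p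
        \<le> (c * frac_weight \<alpha> p T (x + u * r, x + u / 2 * r')) * dist (path_ext (x + u * r)) (path_ext (x + u / 2 * r')) powr p"
      by (metis mult_right_mono mult_1 powr_ge_zero)
    then show ?thesis
      by (simp add: H_def c_def ennreal_mult'[symmetric] ennreal_mult''[symmetric] mult.assoc ennreal_leI)
  next
    case True
    show ?thesis unfolding True by simp
  qed
  have "(\<integral>\<^sup>+ r. \<integral>\<^sup>+ r'. ennreal (dist (path_ext (x + u * r)) (path_ext (x + u / 2 * r')) powr p) \<partial>unit_uniform \<partial>unit_uniform)
      \<le> (\<integral>\<^sup>+ r. \<integral>\<^sup>+ r'. ennreal c * H (x + u * r, x + u / 2 * r') \<partial>unit_uniform \<partial>unit_uniform)"
    using pointwise by (intro nn_integral_mono) auto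
  also have "\<dots> \<le> (\<integral>\<^sup>+ r. \<integral>\<^sup>+ r'. ennreal c * H (x + u * r, x + u / 2 * r') \<partial>lborel \<partial>lborel)"
    by (intro order_trans[OF nn_integral_unit_uniform_le] nn_integral_mono nn_integral_unit_uniform_le)
  also have "\<dots> = ennreal (1 / (\<bar>u\<bar> * \<bar>u / 2\<bar>)) * (\<integral>\<^sup>+ z. ennreal c * H z \<partial>(lborel \<Otimes>\<^sub>M lborel))"
    using u by (intro nn_integral_lborel_pair_affine) auto
  also have "\<dots> = ennreal (1 / (\<bar>u\<bar> * \<bar>u / 2\<bar>)) * (ennreal c * (\<integral>\<^sup>+ z. H z \<partial>(lborel \<Otimes>\<^sub>M lborel)))"
    by (simp add: nn_integral_cmult)
  also have "\<dots> \<le> ennreal (1 / (\<bar>u\<bar> * \<bar>u / 2\<bar>)) * (ennreal c * ennreal C)"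
    by (intro mult_left_mono) (use \<open>_ \<le> ennreal C\<close> in auto)
  also have "\<dots> = ennreal (1 / (\<bar>u\<bar> * \<bar>u / 2\<bar>) * (c * C))"
  proof -
    have c: "0 \<le> c" by (simp add: c_def)
    then have "ennreal c * ennreal C = ennreal (c * C)" using C by (simp add: ennreal_mult)
    then show ?thesis using c C by (simp only:) (rule ennreal_mult[symmetric], auto)
  qed
  also have "1 / (\<bar>u\<bar> * \<bar>u / 2\<bar>) * (c * C) = increment_bound u powr p"
  proof -
    have "c = \<bar>u\<bar> powr (\<alpha> * p - 1) * \<bar>u\<bar> powr 2"
      unfolding c_def powr_add[symmetric] by (simp add: algebra_simps)
    then have c: "c = \<bar>u\<bar> powr (\<alpha> * p - 1) * (\<bar>u\<bar> * \<bar>u\<bar>)"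
      using u by (simp add: powr_numeral power2_eq_square)
    have "increment_bound u powr p = 2 * C * \<bar>u\<bar> powr (\<alpha> * p - 1)"
    proof -
      have "(\<alpha> - 1 / p) * p = \<alpha> * p - 1" using p by (simp add: field_simps)
      then show ?thesis unfolding increment_bound_def using p C by (simp add: powr_mult powr_powr)
    qed
    then show ?thesis unfolding c using u by (simp add: field_simps)
  qed
  finally show ?thesis .
qed

text \<open>The triangle inequality passes through a point of the half segment, averaged as well.
  With \<open>l = increment_bound u\<close> in \<open>le_add_powr\<close>, the cost is
  \<open>l + l powr (1 - p) * l powr p = 2 * l\<close>.\<close>

lemma average_step:
  assumes x: "x \<in> {0..T}" "x + u \<in> {0..T}" and u: "u \<noteq> 0"
  shows "average x u \<le> average x (u / 2) + ennreal (2 * increment_bound u)"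
proof -
  interpret U: prob_space unit_uniform by (rule prob_space_unit_uniform)
  define l where "l = increment_bound u"
  have l: "l > 0" using C u by (simp add: l_def increment_bound_def)
  let ?d = "\<lambda>r r'. dist (path_ext (x + u * r)) (path_ext (x + u / 2 * r'))"
  \<comment> \<open>The idle integration over \<open>r'\<close> is free because
    \<open>unit_uniform\<close> has mass one.\<close>
  have "average x u = (\<integral>\<^sup>+ r. \<integral>\<^sup>+ r'. edist (path_ext x) (path_ext (x + u * r)) \<partial>unit_uniform \<partial>unit_uniform)"
    by (simp add: average_def)
  also have "\<dots> \<le> (\<integral>\<^sup>+ r. \<integral>\<^sup>+ r'. edist (path_ext x) (path_ext (x + u / 2 * r')) +
      (ennreal l + ennreal (l powr (1 - p)) * ennreal (?d r r' powr p)) \<partial>unit_uniform \<partial>unit_uniform)"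
  proof (intro nn_integral_mono)
    fix r r'
    have "dist (path_ext x) (path_ext (x + u * r)) \<le> dist (path_ext x) (path_ext (x + u / 2 * r')) + ?d r r'"
      by (metis dist_commute dist_triangle)
    also have "\<dots> \<le> dist (path_ext x) (path_ext (x + u / 2 * r')) + (l + l powr (1 - p) * ?d r r' powr p)"
      using le_add_powr[of "?d r r'" l p] l p by simp
    finally show "edist (path_ext x) (path_ext (x + u * r)) \<le> edist (path_ext x) (path_ext (x + u / 2 * r')) +
        (ennreal l + ennreal (l powr (1 - p)) * ennreal (?d r r' powr p))"
      using l by (simp add: ennreal_mult'[symmetric] ennreal_plus[symmetric] ennreal_leI del: ennreal_plus)
  qed
  also have "\<dots> = average x (u / 2) + (ennreal l + ennreal (l powr (1 - p)) *
      (\<integral>\<^sup>+ r. \<integral>\<^sup>+ r'. ennreal (?d r r' powr p) \<partial>unit_uniform \<partial>unit_uniform))"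
    by (simp add: nn_integral_add nn_integral_cmult average_def)
  also have "\<dots> \<le> average x (u / 2) + (ennreal l + ennreal (l powr (1 - p)) * ennreal (l powr p))"
    using double_average_le[OF x u] unfolding l_def by (intro add_left_mono mult_left_mono) auto
  also have "ennreal l + ennreal (l powr (1 - p)) * ennreal (l powr p) = ennreal (2 * l)"
    using l by (simp add: ennreal_mult'[symmetric] powr_add[symmetric] ennreal_plus[symmetric] del: ennreal_plus)
  finally show ?thesis by (simp add: l_def)
qed

text \<open>The factor by which \<open>increment_bound\<close> shrinks when \<open>u\<close> is
  halved.\<close>

definition ratio :: real
  where "ratio = (1 / 2) powr (\<alpha> - 1 / p)"

lemma ratio: "0 < ratio" "ratio < 1"
  using \<alpha> powr_less_mono2[of "\<alpha> - 1 / p" "1 / 2" 1] by (auto simp: ratio_def)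

lemma average_le:
  assumes x: "x \<in> {0..T}" "x + u \<in> {0..T}"
  shows "average x u \<le> ennreal (2 * increment_bound u / (1 - ratio))"
proof (cases "u = 0")
  case True
  then show ?thesis by (simp add: average_def)
next
  case u: False
  have increment_bound_nonneg: "0 \<le> increment_bound u" by (simp add: increment_bound_def)
  have sum: "average x u \<le> average x (u / 2 ^ n) + ennreal (2 * increment_bound u * ((1 - ratio ^ n) / (1 - ratio)))" for n
  proof (induction n)
    case (Suc n)
    have "x + u * (1 / 2 ^ n) \<in> {0..T}" using x by (rule segment_in) simp
    then have "average x (u / 2 ^ n) \<le> average x (u / 2 ^ n / 2) + ennreal (2 * increment_bound (u / 2 ^ n))"
      using x u by (intro average_step) auto
    also have "u / 2 ^ n / 2 = u / 2 ^ Suc n" by simp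
    also have "increment_bound (u / 2 ^ n) = increment_bound u * ratio ^ n"
    proof -
      have "ratio ^ n = (1 / 2 ^ n) powr (\<alpha> - 1 / p)"
        unfolding ratio_def by (simp add: powr_realpow[symmetric] powr_powr powr_divide mult.commute)
      moreover have "\<bar>u / 2 ^ n\<bar> powr (\<alpha> - 1 / p) = \<bar>u\<bar> powr (\<alpha> - 1 / p) * (1 / 2 ^ n) powr (\<alpha> - 1 / p)"
        by (simp add: powr_mult[symmetric])
      ultimately show ?thesis unfolding increment_bound_def by simp
    qed
    finally have "average x u \<le> average x (u / 2 ^ Suc n) + ennreal (2 * (increment_bound u * ratio ^ n))
        + ennreal (2 * increment_bound u * ((1 - ratio ^ n) / (1 - ratio)))"
      using Suc by (meson add_right_mono order_trans)
    also have "\<dots> = average x (u / 2 ^ Suc n) +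
        ennreal (2 * (increment_bound u * ratio ^ n) + 2 * increment_bound u * ((1 - ratio ^ n) / (1 - ratio)))"
      using increment_bound_nonneg ratio by (subst ennreal_plus) (auto simp: add.assoc power_le_one)
    also have "2 * (increment_bound u * ratio ^ n) + 2 * increment_bound u * ((1 - ratio ^ n) / (1 - ratio))
        = 2 * increment_bound u * ((1 - ratio ^ Suc n) / (1 - ratio))"
      using ratio by (simp add: field_simps)
    finally show ?case .
  qed simp
  show ?thesis
  \<comment> \<open>After enough halvings the remaining segment is so short that continuity at
    \<open>x\<close> bounds its average by \<open>e\<close>.\<close>
  proof (rule ennreal_le_epsilon)
    fix e :: real assume e: "0 < e"
    have "continuous (at x) path_ext"
      using continuous_path_clamp[OF T \<gamma>] unfolding path_ext_def
      by (simp add: continuous_on_eq_continuous_at)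
    then obtain d where d: "d > 0" "\<And>y. dist y x < d \<Longrightarrow> dist (path_ext y) (path_ext x) < e"
      using e unfolding continuous_at_eps_delta by blast
    obtain n where n: "\<bar>u\<bar> / d < 2 ^ n" using real_arch_pow[of 2 "\<bar>u\<bar> / d"] by auto
    have "average x (u / 2 ^ n) \<le> (\<integral>\<^sup>+ r. ennreal e \<partial>unit_uniform)"
      unfolding average_def
    proof (intro nn_integral_mono ennreal_leI less_imp_le)
      fix r assume "r \<in> space unit_uniform"
      then have r: "r \<in> {0..1}" by simp
      have "\<bar>u / 2 ^ n * r\<bar> \<le> \<bar>u / 2 ^ n\<bar> * 1"
        unfolding abs_mult using r by (intro mult_left_mono) auto
      also have "\<dots> < d" using n d(1) by (simp add: field_simps)
      finally have "dist (x + u / 2 ^ n * r) x < d" by (simp add: dist_real_def)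
      then show "dist (path_ext x) (path_ext (x + u / 2 ^ n * r)) < e" using d(2) by (metis dist_commute)
    qed
    then have "average x u \<le> ennreal e + ennreal (2 * increment_bound u * ((1 - ratio ^ n) / (1 - ratio)))"
      using order_trans[OF sum[of n] add_right_mono] by simp
    also have "\<dots> \<le> ennreal e + ennreal (2 * increment_bound u / (1 - ratio))"
    proof (intro add_left_mono ennreal_leI)
      have "2 * increment_bound u * ((1 - ratio ^ n) / (1 - ratio)) \<le> 2 * increment_bound u * (1 / (1 - ratio))"
        using increment_bound_nonneg ratio by (intro mult_left_mono divide_right_mono) auto
      then show "2 * increment_bound u * ((1 - ratio ^ n) / (1 - ratio)) \<le> 2 * increment_bound u / (1 - ratio)" by simp
    qed
    finally show "average x u \<le> ennreal (2 * increment_bound u / (1 - ratio)) + ennreal e" by (simp add: add.commute)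
  qed
qed

text \<open>Averaging the triangle inequality through the points of the segment from
  \<open>s\<close> to \<open>t\<close> leaves one average from each end, bounded by
  \<open>average_le\<close>; the two factors 2 add up to 4.\<close>

lemma hoelder:
  assumes s: "s \<in> {0..T}" and t: "t \<in> {0..T}"
  shows "dist (\<gamma> s) (\<gamma> t) \<le> 4 * increment_bound (t - s) / (1 - ratio)"
proof -
  have increment_bound: "increment_bound (s - t) = increment_bound (t - s)" "0 \<le> increment_bound (t - s)"
    by (simp_all add: increment_bound_def abs_minus_commute)
  have "edist (path_ext s) (path_ext t) = (\<integral>\<^sup>+ r. edist (path_ext s) (path_ext t) \<partial>unit_uniform)" by simp
  also have "\<dots> \<le> (\<integral>\<^sup>+ r. edist (path_ext s) (path_ext (s + (t - s) * r)) + edist (path_ext t) (path_ext (s + (t - s) * r)) \<partial>unit_uniform)"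
    by (intro nn_integral_mono) (simp add: ennreal_plus[symmetric] dist_triangle2 del: ennreal_plus)
  also have "\<dots> = average s (t - s) + (\<integral>\<^sup>+ r. edist (path_ext t) (path_ext (s + (t - s) * r)) \<partial>unit_uniform)"
    by (simp add: nn_integral_add average_def)
  also have "(\<integral>\<^sup>+ r. edist (path_ext t) (path_ext (s + (t - s) * r)) \<partial>unit_uniform)
      = (\<integral>\<^sup>+ r. edist (path_ext t) (path_ext (s + (t - s) * (1 - r))) \<partial>unit_uniform)"
    by (rule nn_integral_unit_uniform_reflect[symmetric]) auto
  also have "\<dots> = average t (s - t)"
    unfolding average_def by (intro nn_integral_cong) (simp add: algebra_simps)
  also have "average s (t - s) + average t (s - t)
      \<le> ennreal (2 * increment_bound (t - s) / (1 - ratio)) + ennreal (2 * increment_bound (s - t) / (1 - ratio))"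
    using s t by (intro add_mono average_le) auto
  also have "\<dots> = ennreal (4 * increment_bound (t - s) / (1 - ratio))"
    using increment_bound ratio by (simp add: ennreal_plus[symmetric] add_divide_distrib[symmetric] del: ennreal_plus)
  finally have "dist (path_ext s) (path_ext t) \<le> 4 * increment_bound (t - s) / (1 - ratio)"
    using increment_bound ratio by (simp add: ennreal_le_iff)
  then show ?thesis using s t by (simp add: path_ext_def clamp_time_id)
qed

end

lemma frac_equicontinuous:
  fixes C :: ennreal
  assumes p: "1 < p" and \<alpha>: "1 / p < \<alpha>" and T: "0 \<le> T" and C: "C < \<infinity>" and e: "0 < e"
  shows "\<exists>d>0. \<forall>\<gamma>\<in>mspace (path_metric T :: (real \<Rightarrow> 'a::{metric_space, second_countable_topology}) metric).
    frac_energy \<alpha> p T edist \<gamma> \<le> C \<longrightarrow>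
    (\<forall>s\<in>{0..T}. \<forall>t\<in>{0..T}. dist s t < d \<longrightarrow> dist (\<gamma> s) (\<gamma> t) < e)"
proof -
  \<comment> \<open>Adding one makes the bound positive even if \<open>C = 0\<close>, as
    \<open>frac_bounded_path\<close> asks.\<close>
  define C' where "C' = enn2real C + 1"
  have C': "0 < C'" "C \<le> ennreal C'" using C
    by (auto simp: C'_def add_nonneg_pos)
  define B where "B = 4 * (2 * C') powr (1 / p) / (1 - (1 / 2) powr (\<alpha> - 1 / p))"
  have q: "(1 / 2) powr (\<alpha> - 1 / p) < (1 :: real)"
    using \<alpha> powr_less_mono2[of "\<alpha> - 1 / p" "1 / 2" 1] by simp
  have B: "B > 0" unfolding B_def using q C'(1) by (intro divide_pos_pos) auto
  \<comment> \<open>The solution of \<open>B * d powr (\<alpha> - 1 / p) = e\<close>.\<close>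
  define d where "d = (e / B) powr (1 / (\<alpha> - 1 / p))"
  have "dist (\<gamma> s) (\<gamma> t) < e"
    if \<gamma>: "\<gamma> \<in> mspace (path_metric T)" "frac_energy \<alpha> p T edist \<gamma> \<le> C"
      and st: "s \<in> {0..T}" "t \<in> {0..T}" "dist s t < d" for \<gamma> :: "real \<Rightarrow> 'a" and s t
  proof -
    interpret frac_bounded_path \<alpha> p T C' \<gamma>
      using p \<alpha> T C' \<gamma> by unfold_locales auto
    have "dist (\<gamma> s) (\<gamma> t) \<le> B * \<bar>t - s\<bar> powr (\<alpha> - 1 / p)"
      using hoelder[OF st(1,2)] by (simp add: increment_bound_def ratio_def B_def)
    also have "\<dots> < B * d powr (\<alpha> - 1 / p)"
      using B st(3) \<alpha> by (intro mult_strict_left_mono powr_less_mono2) (auto simp: dist_real_def abs_minus_commute)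
    also have "\<dots> = e" using B e \<alpha> by (simp add: d_def powr_powr)
    finally show ?thesis .
  qed
  moreover have "d > 0" using e B by (simp add: d_def)
  ultimately show ?thesis by blast
qed

text \<open>\<open>\<pi>0\<close> is a competitor with finite integral, so the minimum is finite; a
  finite integral forces finite energy almost surely, which is the concentration claim.\<close>

lemma (in pair_weight) energy_minimizer_properties:
  fixes \<mu> :: "real \<Rightarrow> 'a::{polish_space, heine_borel} measure"
  assumes equi: "\<And>C e. C < \<infinity> \<Longrightarrow> 0 < e \<Longrightarrow> \<exists>d>0. \<forall>\<gamma>\<in>mspace (path_metric T :: (real \<Rightarrow> 'a) metric). energy \<gamma> \<le> C \<longrightarrow>
      (\<forall>s\<in>{0..T}. \<forall>t\<in>{0..T}. dist s t < d \<longrightarrow> dist (\<gamma> s) (\<gamma> t) < e)"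
    and moment: "\<mu> 0 \<in> finite_moment_probs p"
    and lift: "\<pi>0 \<in> lifts T \<mu>" "(\<integral>\<^sup>+ \<gamma>. (ennreal (dist (\<gamma> 0) x0 powr p) + energy \<gamma>) \<partial>\<pi>0) < \<infinity>"
  shows "\<exists>\<pi>\<in>space (prob_algebra (path_borel T)).
    is_arg_min (\<lambda>\<pi>'. \<integral>\<^sup>+ \<gamma>. energy \<gamma> \<partial>\<pi>') (\<lambda>\<pi>'. \<pi>' \<in> lifts T \<mu>) \<pi> \<and>
    emeasure \<pi> {\<gamma> \<in> mspace (path_metric T). energy \<gamma> < \<infinity>} = 1 \<and>
    (\<forall>t\<in>{0..T}. distr \<pi> borel (\<lambda>\<gamma>. \<gamma> t) = \<mu> t) \<and>
    pair_energy M w a b p (wasserstein p) \<mu> \<le> (\<integral>\<^sup>+ \<gamma>. energy \<gamma> \<partial>\<pi>) \<and>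
    (\<integral>\<^sup>+ \<gamma>. energy \<gamma> \<partial>\<pi>) < \<infinity>"
proof -
  have "lifts T \<mu> \<noteq> {}" using lift(1) by blast
  with moment have "\<exists>\<pi>\<in>lifts T \<mu>. \<forall>\<pi>'\<in>lifts T \<mu>. (\<integral>\<^sup>+ \<gamma>. energy \<gamma> \<partial>\<pi>) \<le> (\<integral>\<^sup>+ \<gamma>. energy \<gamma> \<partial>\<pi>')"
    by (rule energy_minimizer_exists[rotated]) (rule equi)
  then obtain \<pi> where \<pi>: "\<pi> \<in> lifts T \<mu>"
    "\<And>\<pi>'. \<pi>' \<in> lifts T \<mu> \<Longrightarrow> (\<integral>\<^sup>+ \<gamma>. energy \<gamma> \<partial>\<pi>) \<le> (\<integral>\<^sup>+ \<gamma>. energy \<gamma> \<partial>\<pi>')"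
    by blast
  interpret \<pi>: prob_space \<pi> by (rule liftsD[OF \<pi>(1)])
  have [measurable]: "(energy :: (real \<Rightarrow> 'a) \<Rightarrow> ennreal) \<in> borel_measurable \<pi>"
    using measurable_energy liftsD(2)[OF \<pi>(1)] by (simp cong: measurable_cong_sets)
  have "(\<integral>\<^sup>+ \<gamma>. energy \<gamma> \<partial>\<pi>) \<le> (\<integral>\<^sup>+ \<gamma>. energy \<gamma> \<partial>\<pi>0)" by (rule \<pi>(2)[OF lift(1)])
  also have "\<dots> \<le> (\<integral>\<^sup>+ \<gamma>. (ennreal (dist (\<gamma> 0) x0 powr p) + energy \<gamma>) \<partial>\<pi>0)"
    by (intro nn_integral_mono) simp
  finally have fin: "(\<integral>\<^sup>+ \<gamma>. energy \<gamma> \<partial>\<pi>) < \<infinity>" using lift(2) by (rule le_less_trans)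
  have "AE \<gamma> in \<pi>. energy \<gamma> \<noteq> \<infinity>" using fin by (intro nn_integral_noteq_infinite) auto
  then have "emeasure \<pi> {\<gamma> \<in> space \<pi>. energy \<gamma> < \<infinity>} = 1"
    by (intro \<pi>.emeasure_eq_1_AE) (auto simp: less_top elim!: eventually_mono)
  moreover have "is_arg_min (\<lambda>\<pi>'. \<integral>\<^sup>+ \<gamma>. energy \<gamma> \<partial>\<pi>') (\<lambda>\<pi>'. \<pi>' \<in> lifts T \<mu>) \<pi>"
    using \<pi> by (auto simp: is_arg_min_def not_less)
  moreover have "\<pi> \<in> space (prob_algebra (path_borel T))" using \<pi>(1) by (simp add: lifts_def)
  ultimately show ?thesis
    using fin wasserstein_energy_le[OF \<pi>(1)] liftsD(3,4)[OF \<pi>(1)] by (intro bexI[of _ \<pi>]) auto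
qed

theorem theorem1p3:
  fixes p \<alpha> :: real
  assumes "1 < p" and "1 / p < \<alpha>" and "\<alpha> < 1"
  shows
    "(\<forall>(T :: real) (\<mu> :: real \<Rightarrow> 'a::{polish_space, heine_borel} measure).
        0 \<le> T \<longrightarrow>
        (\<forall>t\<in>{0..T}. \<mu> t \<in> space (prob_algebra borel)) \<longrightarrow>
        \<mu> 0 \<in> finite_moment_probs p \<longrightarrow>
        (\<exists>\<pi>'\<in>lifts T \<mu>. \<exists>x0.
          (\<integral>\<^sup>+ \<gamma>. (ennreal (dist (\<gamma> 0) x0 powr p)
                  + ennreal_powr (frac_seminorm edist \<alpha> p T \<gamma>) p) \<partial>\<pi>') < \<infinity>) \<longrightarrow>
        (\<exists>\<pi> \<in> space (prob_algebra (path_borel T)).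
          is_arg_min (\<lambda>\<pi>'. \<integral>\<^sup>+ \<gamma>. ennreal_powr (frac_seminorm edist \<alpha> p T \<gamma>) p \<partial>\<pi>')
            (\<lambda>\<pi>'. \<pi>' \<in> lifts T \<mu>) \<pi> \<and>
          emeasure \<pi> (frac_paths \<alpha> p T) = 1 \<and>
          (\<forall>t\<in>{0..T}. distr \<pi> borel (\<lambda>\<gamma>. \<gamma> t) = \<mu> t) \<and>
          ennreal_powr (frac_seminorm (wasserstein p) \<alpha> p T \<mu>) p
            \<le> (\<integral>\<^sup>+ \<gamma>. ennreal_powr (frac_seminorm edist \<alpha> p T \<gamma>) p \<partial>\<pi>) \<and>
          (\<integral>\<^sup>+ \<gamma>. ennreal_powr (frac_seminorm edist \<alpha> p T \<gamma>) p \<partial>\<pi>) < \<infinity>)) \<and>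
     (\<forall>\<mu> :: real \<Rightarrow> 'a measure.
        (\<forall>t\<in>{0..1}. \<mu> t \<in> space (prob_algebra borel)) \<longrightarrow>
        \<mu> 0 \<in> finite_moment_probs p \<longrightarrow>
        (\<exists>\<pi>'\<in>lifts 1 \<mu>. \<exists>x0.
          (\<integral>\<^sup>+ \<gamma>. (ennreal (dist (\<gamma> 0) x0 powr p)
                  + ennreal_powr (dyadic_seminorm edist \<alpha> p \<gamma>) p) \<partial>\<pi>') < \<infinity>) \<longrightarrow>
        (\<exists>\<pi> \<in> space (prob_algebra (path_borel 1)).
          is_arg_min (\<lambda>\<pi>'. \<integral>\<^sup>+ \<gamma>. ennreal_powr (dyadic_seminorm edist \<alpha> p \<gamma>) p \<partial>\<pi>')
            (\<lambda>\<pi>'. \<pi>' \<in> lifts 1 \<mu>) \<pi> \<and>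
          emeasure \<pi> (dyadic_paths \<alpha> p) = 1 \<and>
          (\<forall>t\<in>{0..1}. distr \<pi> borel (\<lambda>\<gamma>. \<gamma> t) = \<mu> t) \<and>
          ennreal_powr (dyadic_seminorm (wasserstein p) \<alpha> p \<mu>) p
            \<le> (\<integral>\<^sup>+ \<gamma>. ennreal_powr (dyadic_seminorm edist \<alpha> p \<gamma>) p \<partial>\<pi>) \<and>
          (\<integral>\<^sup>+ \<gamma>. ennreal_powr (dyadic_seminorm edist \<alpha> p \<gamma>) p \<partial>\<pi>) < \<infinity>))"
proof (intro conjI allI impI)
  have p: "0 < p" using assms by simp
  have edist_diag: "ennreal_powr (edist x x) p = 0" for x :: 'a
    by (simp add: ennreal_powr_def)
  fix T :: real and \<mu> :: "real \<Rightarrow> 'a measure"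
  assume T: "0 \<le> T" and moment: "\<mu> 0 \<in> finite_moment_probs p"
    and "\<exists>\<pi>'\<in>lifts T \<mu>. \<exists>x0. (\<integral>\<^sup>+ \<gamma>. (ennreal (dist (\<gamma> 0) x0 powr p)
                  + ennreal_powr (frac_seminorm edist \<alpha> p T \<gamma>) p) \<partial>\<pi>') < \<infinity>"
  then obtain \<pi>0 x0 where \<pi>0: "\<pi>0 \<in> lifts T \<mu>"
      "(\<integral>\<^sup>+ \<gamma>. (ennreal (dist (\<gamma> 0) x0 powr p) + frac_energy \<alpha> p T edist \<gamma>) \<partial>\<pi>0) < \<infinity>"
    unfolding frac_seminorm_powr[where \<rho> = edist, OF p edist_diag] by blast
  interpret pair_weight "lborel \<Otimes>\<^sub>M lborel" "frac_weight \<alpha> p T"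
    "\<lambda>z. clamp_time T (fst z)" "\<lambda>z. clamp_time T (snd z)" p T
    by (rule pair_weight_frac[OF p T])
  \<comment> \<open>The law of \<open>(\<gamma> t, \<gamma> t)\<close> under \<open>\<pi>0\<close>
    is a coupling of cost zero. The rewriting of the seminorm needs this on the diagonal, where the
    weight takes its default value.\<close>
  have wasserstein_diag: "ennreal_powr (wasserstein p (\<mu> t) (\<mu> t)) p = 0" if "t \<in> {0..T}" for t
    using wasserstein_powr_le[OF p \<pi>0(1) that that] by simp
  have wasserstein_seminorm: "ennreal_powr (frac_seminorm (wasserstein p) \<alpha> p T \<mu>) p = frac_energy \<alpha> p T (wasserstein p) \<mu>"
    by (rule frac_seminorm_powr[OF p]) (rule wasserstein_diag)
  have paths: "frac_paths \<alpha> p T = {\<gamma> \<in> mspace (path_metric T :: (real \<Rightarrow> 'a) metric). frac_energy \<alpha> p T edist \<gamma> < \<infinity>}"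
    unfolding frac_paths_def frac_seminorm_powr[where \<rho> = edist, OF p edist_diag, symmetric]
      ennreal_powr_less_top ..
  show "\<exists>\<pi> \<in> space (prob_algebra (path_borel T)).
          is_arg_min (\<lambda>\<pi>'. \<integral>\<^sup>+ \<gamma>. ennreal_powr (frac_seminorm edist \<alpha> p T \<gamma>) p \<partial>\<pi>')
            (\<lambda>\<pi>'. \<pi>' \<in> lifts T \<mu>) \<pi> \<and>
          emeasure \<pi> (frac_paths \<alpha> p T) = 1 \<and>
          (\<forall>t\<in>{0..T}. distr \<pi> borel (\<lambda>\<gamma>. \<gamma> t) = \<mu> t) \<and>
          ennreal_powr (frac_seminorm (wasserstein p) \<alpha> p T \<mu>) p
            \<le> (\<integral>\<^sup>+ \<gamma>. ennreal_powr (frac_seminorm edist \<alpha> p T \<gamma>) p \<partial>\<pi>) \<and>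
          (\<integral>\<^sup>+ \<gamma>. ennreal_powr (frac_seminorm edist \<alpha> p T \<gamma>) p \<partial>\<pi>) < \<infinity>"
    unfolding paths frac_seminorm_powr[where \<rho> = edist, OF p edist_diag] wasserstein_seminorm
    by (rule energy_minimizer_properties[OF _ moment \<pi>0]) (rule frac_equicontinuous[OF assms(1,2) T])
next
  have p: "0 < p" using assms by simp
  fix \<mu> :: "real \<Rightarrow> 'a measure"
  assume moment: "\<mu> 0 \<in> finite_moment_probs p"
    and "\<exists>\<pi>'\<in>lifts 1 \<mu>. \<exists>x0. (\<integral>\<^sup>+ \<gamma>. (ennreal (dist (\<gamma> 0) x0 powr p)
                  + ennreal_powr (dyadic_seminorm edist \<alpha> p \<gamma>) p) \<partial>\<pi>') < \<infinity>"
  then obtain \<pi>0 x0 where \<pi>0: "\<pi>0 \<in> lifts 1 \<mu>"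
      "(\<integral>\<^sup>+ \<gamma>. (ennreal (dist (\<gamma> 0) x0 powr p) + dyadic_energy \<alpha> p edist \<gamma>) \<partial>\<pi>0) < \<infinity>"
    unfolding dyadic_seminorm_powr[OF p] by blast
  interpret pair_weight "count_space UNIV" "dyadic_weight \<alpha> p"
    "\<lambda>z. clamp_time 1 (real (snd z) / 2 ^ fst z)" "\<lambda>z. clamp_time 1 (real (snd z + 1) / 2 ^ fst z)" p 1
    by (rule pair_weight_dyadic[OF p])
  have paths: "dyadic_paths \<alpha> p = {\<gamma> \<in> mspace (path_metric 1 :: (real \<Rightarrow> 'a) metric). dyadic_energy \<alpha> p edist \<gamma> < \<infinity>}"
    unfolding dyadic_paths_def dyadic_seminorm_powr[OF p, symmetric] ennreal_powr_less_top ..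
  show "\<exists>\<pi> \<in> space (prob_algebra (path_borel 1)).
          is_arg_min (\<lambda>\<pi>'. \<integral>\<^sup>+ \<gamma>. ennreal_powr (dyadic_seminorm edist \<alpha> p \<gamma>) p \<partial>\<pi>')
            (\<lambda>\<pi>'. \<pi>' \<in> lifts 1 \<mu>) \<pi> \<and>
          emeasure \<pi> (dyadic_paths \<alpha> p) = 1 \<and>
          (\<forall>t\<in>{0..1}. distr \<pi> borel (\<lambda>\<gamma>. \<gamma> t) = \<mu> t) \<and>
          ennreal_powr (dyadic_seminorm (wasserstein p) \<alpha> p \<mu>) p
            \<le> (\<integral>\<^sup>+ \<gamma>. ennreal_powr (dyadic_seminorm edist \<alpha> p \<gamma>) p \<partial>\<pi>) \<and>
          (\<integral>\<^sup>+ \<gamma>. ennreal_powr (dyadic_seminorm edist \<alpha> p \<gamma>) p \<partial>\<pi>) < \<infinity>"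
    unfolding paths dyadic_seminorm_powr[OF p]
    by (rule energy_minimizer_properties[OF _ moment \<pi>0]) (rule dyadic_equicontinuous[OF p assms(2)])
qed

end
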